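(* Let $M>0$, $|a|=M$, and let $g_{M,a}$ be the extremal Kerr metric. For smooth future-horizon regular axisymmetric solutions of $$\Box_{g_{M,a}}u=0,\qquad\partial_\phi u=0,$$ the future horizon $\mathcal H^+=\{r=M\}$ carries the conserved charge $$\mathfrak A^{\rm Kerr}_0[u](v)=\int_0^\pi\bigl(4M^2\partial_ru+2Mu+M^2\sin^2\theta\,\partial_vu\bigr)(v,M,\theta)\sin\theta\,d\theta,$$ i.e. $\mathfrak A^{\rm Kerr}_0[u](v)$ is independent of $v$. If $\mathfrak A^{\rm Kerr}_0[u]\ne0$ and the tangential horizon quantities $u$ and $\partial_vu$ decay (tend to $0$ as $v\to\infty$) along $\mathcal H^+$, then the averaged transversal derivative $\int_0^\pi\partial_ru(v,M,\theta)\sin\theta\,d\theta$ does not tend to $0$ as $v\to\infty$. In the decaying radiation energy space there is no nonzero smooth stationary zero-frequency state satisfying both future-horizon regularity and decay at infinity.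
   Context: With $\Delta=(r-M)^2$, $a^2=M^2$, $\rho^2=r^2+a^2\cos^2\theta$, $$g_{M,a}=-\frac{\Delta}{\rho^2}(dt-a\sin^2\theta\,d\phi)^2+\frac{\sin^2\theta}{\rho^2}((r^2+a^2)d\phi-a\,dt)^2+\frac{\rho^2}{\Delta}dr^2+\rho^2d\theta^2,\qquad r>M .$$ Derivatives in the charge are in the ingoing coordinates $(v,r,\theta,\phi_{\rm in})$, $v=t+r_*$, $\phi_{\rm in}=\phi+\int^r\frac{a}{\Delta(s)}ds$, $\frac{dr_*}{dr}=\frac{r^2+a^2}{\Delta}$, in which the metric extends smoothly across $r=M$. Future-horizon regular means smooth up to $r=M$ (and smooth at the poles $\theta=0,\pi$) in these coordinates. Decay along $\mathcal H^+$ is understood uniformly in $\theta$. A stationary zero-frequency state is a time-independent axisymmetric solution $u=\psi(r,\theta)$ of $\Box_gu=0$. The decaying radiation energy space consists of data on a hypersurface crossing the horizon and reaching spatial infinity, in the closure of smooth decaying data under a norm with square equivalent to $\int(|\nabla u_0|^2+|u_1|^2+r^{-2}|u_0|^2)$; nonzero constants are excluded. *)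

theory Defs
  imports "HOL-Analysis.Analysis"
begin

section \<open>Smooth functions\<close>

text \<open>The domain is meant to be open: all derivatives are two-sided Frechet derivatives.\<close>

primrec Ck_on :: "nat \<Rightarrow> 'a::real_normed_vector set \<Rightarrow> ('a \<Rightarrow> real) \<Rightarrow> bool" where
  "Ck_on 0 S f \<longleftrightarrow> continuous_on S f"
| "Ck_on (Suc k) S f \<longleftrightarrow>
     (\<forall>x\<in>S. f differentiable (at x)) \<and>
     (\<forall>w. Ck_on k S (\<lambda>x. frechet_derivative f (at x) w))"

definition smooth_on :: "'a::real_normed_vector set \<Rightarrow> ('a \<Rightarrow> real) \<Rightarrow> bool" where
  "smooth_on S f \<longleftrightarrow> (\<forall>k. Ck_on k S f)"

text \<open>Smoothness on a set with boundary, in the usual sense that \<open>f\<close> is the restriction of a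
  smooth function on an open neighbourhood; the values of \<open>f\<close> outside \<open>S\<close> are irrelevant.\<close>

definition smooth_up_to_boundary :: "'a::real_normed_vector set \<Rightarrow> ('a \<Rightarrow> real) \<Rightarrow> bool" where
  "smooth_up_to_boundary S f \<longleftrightarrow>
     (\<exists>W F. open W \<and> S \<subseteq> W \<and> smooth_on W F \<and> (\<forall>x\<in>S. F x = f x))"

section \<open>The wave operator of a metric given in coordinates\<close>

definition partial :: "'n::finite \<Rightarrow> (real^'n \<Rightarrow> real) \<Rightarrow> real^'n \<Rightarrow> real" where
  "partial i f p = deriv (\<lambda>s. f (p + s *\<^sub>R axis i 1)) 0"

definition wave_operator :: "(real^'n \<Rightarrow> real^'n^'n) \<Rightarrow> (real^'n \<Rightarrow> real) \<Rightarrow> real^'n \<Rightarrow> real" where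
  "wave_operator g f p =
     (1 / sqrt \<bar>det (g p)\<bar>) *
     (\<Sum>i\<in>UNIV. \<Sum>j\<in>UNIV.
        partial i (\<lambda>q. sqrt \<bar>det (g q)\<bar> * matrix_inv (g q) $ i $ j * partial j f q) p)"

section \<open>The extremal Kerr metric\<close>

definition Kerr_Delta :: "real \<Rightarrow> real \<Rightarrow> real" where
  "Kerr_Delta M r = (r - M)\<^sup>2"

definition Kerr_rho2 :: "real \<Rightarrow> real \<Rightarrow> real \<Rightarrow> real" where
  "Kerr_rho2 a r \<theta> = r\<^sup>2 + a\<^sup>2 * (cos \<theta>)\<^sup>2"

definition covector_square :: "real^'n \<Rightarrow> real^'n^'n" where
  "covector_square \<alpha> = (\<chi> i j. \<alpha> $ i * \<alpha> $ j)"

text \<open>Components \<open>1, 2, 3, 4\<close> of a point are the Boyer--Lindquist coordinates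
  \<open>t, r, \<theta>, \<phi>\<close>.\<close>

definition Kerr_metric :: "real \<Rightarrow> real \<Rightarrow> real^4 \<Rightarrow> real^4^4" where
  "Kerr_metric M a p =
     (let r = p $ 2; \<theta> = p $ 3; \<Delta> = Kerr_Delta M r; \<rho>2 = Kerr_rho2 a r \<theta>;
          dt = axis 1 1; dr = axis 2 1; d\<theta> = axis 3 1; d\<phi> = axis 4 1
      in - (\<Delta> / \<rho>2) *\<^sub>R covector_square (dt - (a * (sin \<theta>)\<^sup>2) *\<^sub>R d\<phi>)
         + ((sin \<theta>)\<^sup>2 / \<rho>2) *\<^sub>R covector_square ((r\<^sup>2 + a\<^sup>2) *\<^sub>R d\<phi> - a *\<^sub>R dt)
         + (\<rho>2 / \<Delta>) *\<^sub>R covector_square dr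
         + \<rho>2 *\<^sub>R covector_square d\<theta>)"

section \<open>Ingoing coordinates\<close>

text \<open>The exterior together with its future horizon is \<open>\<real> \<times> {x \<in> \<real>\<^sup>3. M \<le> \<bar>x\<bar>}\<close>, where
  \<open>(v, x)\<close> has ingoing coordinates \<open>v\<close>, \<open>r = \<bar>x\<bar>\<close> and \<open>\<theta>, \<phi>\<close> (meaning the ingoing angle) the
  spherical angles of \<open>x\<close>. Smoothness in \<open>(v, x)\<close> thus includes smoothness at the poles.\<close>

definition spherical :: "real \<Rightarrow> real \<Rightarrow> real \<Rightarrow> real^3" where
  "spherical r \<theta> \<phi> = r *\<^sub>R vector [sin \<theta> * cos \<phi>, sin \<theta> * sin \<phi>, cos \<theta>]"

definition horizon_exterior :: "real \<Rightarrow> (real \<times> (real^3)) set" where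
  "horizon_exterior M = {(v, x). M \<le> norm x}"

definition future_horizon :: "real \<Rightarrow> real set \<Rightarrow> (real \<times> (real^3)) set" where
  "future_horizon M J = {(v, x). v \<in> J \<and> norm x = M}"

definition tortoise :: "real \<Rightarrow> real \<Rightarrow> (real \<Rightarrow> real) \<Rightarrow> bool" where
  "tortoise M a rs \<longleftrightarrow>
     (\<forall>r>M. (rs has_real_derivative (r\<^sup>2 + a\<^sup>2) / Kerr_Delta M r) (at r))"

definition angular_shift :: "real \<Rightarrow> real \<Rightarrow> (real \<Rightarrow> real) \<Rightarrow> bool" where
  "angular_shift M a \<phi>s \<longleftrightarrow>
     (\<forall>r>M. (\<phi>s has_real_derivative a / Kerr_Delta M r) (at r))"

text \<open>From Boyer--Lindquist to ingoing coordinates.\<close>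

definition ingoing_point :: "(real \<Rightarrow> real) \<Rightarrow> (real \<Rightarrow> real) \<Rightarrow> real^4 \<Rightarrow> real \<times> (real^3)" where
  "ingoing_point rs \<phi>s p =
     (p $ 1 + rs (p $ 2), spherical (p $ 2) (p $ 3) (p $ 4 + \<phi>s (p $ 2)))"

section \<open>Regular axisymmetric solutions and the horizon charge\<close>

text \<open>The open set \<open>D\<close> is the region where the solution lives: everything for a global solution,
  or the future of a Cauchy hypersurface. The wave equation is imposed in Boyer--Lindquist
  coordinates in the open exterior off the axis, where these are coordinates; on the axis and the
  horizon it then holds by smoothness.\<close>

definition regular_axisymmetric_solution ::
  "real \<Rightarrow> real \<Rightarrow> (real \<Rightarrow> real) \<Rightarrow> (real \<Rightarrow> real) \<Rightarrow> (real \<times> (real^3)) set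
     \<Rightarrow> (real \<times> (real^3) \<Rightarrow> real) \<Rightarrow> bool" where
  "regular_axisymmetric_solution M a rs \<phi>s D u \<longleftrightarrow>
     smooth_up_to_boundary (D \<inter> horizon_exterior M) u \<and>
     (\<forall>p. M < p $ 2 \<and> 0 < p $ 3 \<and> p $ 3 < pi \<and> ingoing_point rs \<phi>s p \<in> D \<longrightarrow>
        wave_operator (Kerr_metric M a) (u \<circ> ingoing_point rs \<phi>s) p = 0 \<and>
        partial 4 (u \<circ> ingoing_point rs \<phi>s) p = 0)"

text \<open>Horizon values of an axisymmetric function, read off on the meridian \<open>\<phi> = 0\<close>. The
  transversal derivative is one-sided, since \<open>u\<close> matters only for \<open>r \<ge> M\<close>.\<close>

definition horizon_u :: "real \<Rightarrow> (real \<times> (real^3) \<Rightarrow> real) \<Rightarrow> real \<Rightarrow> real \<Rightarrow> real" where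
  "horizon_u M u v \<theta> = u (v, spherical M \<theta> 0)"

definition horizon_dv :: "real \<Rightarrow> (real \<times> (real^3) \<Rightarrow> real) \<Rightarrow> real \<Rightarrow> real \<Rightarrow> real" where
  "horizon_dv M u v \<theta> = deriv (\<lambda>s. u (s, spherical M \<theta> 0)) v"

definition horizon_dr :: "real \<Rightarrow> (real \<times> (real^3) \<Rightarrow> real) \<Rightarrow> real \<Rightarrow> real \<Rightarrow> real" where
  "horizon_dr M u v \<theta> =
     vector_derivative (\<lambda>r. u (v, spherical r \<theta> 0)) (at M within {M..})"

definition Kerr_charge :: "real \<Rightarrow> (real \<times> (real^3) \<Rightarrow> real) \<Rightarrow> real \<Rightarrow> real" where
  "Kerr_charge M u v =
     integral {0..pi} (\<lambda>\<theta>.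
       (4 * M\<^sup>2 * horizon_dr M u v \<theta> + 2 * M * horizon_u M u v \<theta>
         + M\<^sup>2 * (sin \<theta>)\<^sup>2 * horizon_dv M u v \<theta>) * sin \<theta>)"

section \<open>The decaying radiation energy space\<close>

text \<open>The hypersurface is \<open>v = r + \<tau>\<close>. It is spacelike, since
  \<open>g\<^sup>-\<^sup>1(dv - dr, dv - dr) = -(1 + 2 M r / \<rho>\<^sup>2)\<close> up to and including \<open>r = M\<close>, crosses the
  horizon, and reaches spatial infinity because \<open>(v - r) - t = r\<^sub>* - r\<close> grows only
  logarithmically. It is parametrised by \<open>x\<close>.

  In the coordinates \<open>(\<tau>, x)\<close> lapse, inverse lapse and shift are bounded and the induced metric
  is uniformly equivalent to the Euclidean one. Hence, up to equivalence of norms, \<open>u\<^sub>1\<close> may be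
  taken to be \<open>\<partial>\<^sub>v u\<close> instead of the unit normal derivative, and gradient and volume may be
  taken with respect to the Euclidean metric, here written in spherical coordinates.\<close>

definition slice_data :: "real \<Rightarrow> (real \<times> (real^3) \<Rightarrow> real) \<Rightarrow> (real^3 \<Rightarrow> real) \<times> (real^3 \<Rightarrow> real)" where
  "slice_data \<tau> u =
     ((\<lambda>x. u (norm x + \<tau>, x)), (\<lambda>x. deriv (\<lambda>s. u (s, x)) (norm x + \<tau>)))"

definition radiation_energy :: "real \<Rightarrow> (real^3 \<Rightarrow> real) \<Rightarrow> (real^3 \<Rightarrow> real) \<Rightarrow> ennreal" where
  "radiation_energy M u0 u1 =
     (\<integral>\<^sup>+ r\<in>{M<..}. (\<integral>\<^sup>+ \<theta>\<in>{0<..<pi}. (\<integral>\<^sup>+ \<phi>\<in>{0<..<2*pi}.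
        ennreal (((deriv (\<lambda>s. u0 (spherical s \<theta> \<phi>)) r)\<^sup>2
                  + (deriv (\<lambda>s. u0 (spherical r s \<phi>)) \<theta> / r)\<^sup>2
                  + (deriv (\<lambda>s. u0 (spherical r \<theta> s)) \<phi> / (r * sin \<theta>))\<^sup>2
                  + (u1 (spherical r \<theta> \<phi>))\<^sup>2
                  + (u0 (spherical r \<theta> \<phi>))\<^sup>2 / r\<^sup>2) * (r\<^sup>2 * sin \<theta>))
        \<partial>lborel) \<partial>lborel) \<partial>lborel)"

definition smooth_data :: "real \<Rightarrow> (real^3 \<Rightarrow> real) \<Rightarrow> (real^3 \<Rightarrow> real) \<Rightarrow> bool" where
  "smooth_data M u0 u1 \<longleftrightarrow>
     smooth_up_to_boundary {x. M \<le> norm x} u0 \<and> smooth_up_to_boundary {x. M \<le> norm x} u1"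

definition smooth_decaying_data :: "real \<Rightarrow> (real^3 \<Rightarrow> real) \<Rightarrow> (real^3 \<Rightarrow> real) \<Rightarrow> bool" where
  "smooth_decaying_data M u0 u1 \<longleftrightarrow>
     smooth_data M u0 u1 \<and> (u0 \<longlongrightarrow> 0) at_infinity \<and> (u1 \<longlongrightarrow> 0) at_infinity \<and>
     radiation_energy M u0 u1 < \<infinity>"

text \<open>The smooth elements of the closure of the smooth decaying data in the energy norm, for which
  the energy can be written with classical derivatives. Nonzero constants are not in it, because
  of the term \<open>u\<^sub>0\<^sup>2 / r\<^sup>2\<close>.\<close>

definition smooth_radiation_space :: "real \<Rightarrow> ((real^3 \<Rightarrow> real) \<times> (real^3 \<Rightarrow> real)) set" where
  "smooth_radiation_space M =
     {(u0, u1). smooth_data M u0 u1 \<and>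
        (\<forall>\<epsilon>>0. \<exists>f0 f1. smooth_decaying_data M f0 f1 \<and>
           radiation_energy M (\<lambda>x. u0 x - f0 x) (\<lambda>x. u1 x - f1 x) < ennreal \<epsilon>)}"

section \<open>Stationary zero-frequency states\<close>

text \<open>\<open>u = \<psi>(r, \<theta>)\<close> with no dependence on \<open>v\<close> and the ingoing angle, equivalently none on
  \<open>t\<close> and \<open>\<phi>\<close>.\<close>

definition stationary_state ::
  "real \<Rightarrow> real \<Rightarrow> (real \<Rightarrow> real) \<Rightarrow> (real \<Rightarrow> real) \<Rightarrow> (real \<times> (real^3) \<Rightarrow> real)
     \<Rightarrow> (real \<Rightarrow> real \<Rightarrow> real) \<Rightarrow> bool" where
  "stationary_state M a rs \<phi>s u \<psi> \<longleftrightarrow>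
     regular_axisymmetric_solution M a rs \<phi>s UNIV u \<and>
     (\<forall>v r \<theta> \<phi>. M \<le> r \<and> 0 \<le> \<theta> \<and> \<theta> \<le> pi \<longrightarrow> u (v, spherical r \<theta> \<phi>) = \<psi> r \<theta>)"

end

theory Submission
  imports Defs
begin

text \<open>In ingoing coordinates the axisymmetric wave equation, multiplied by \<open>\<rho>\<^sup>2\<close>, reads
  \<open>\<partial>\<^sub>r (\<Delta> \<partial>\<^sub>r u) + 2 (r\<^sup>2 + a\<^sup>2) \<partial>\<^sub>v \<partial>\<^sub>r u + 2 r \<partial>\<^sub>v u + a\<^sup>2 sin\<^sup>2 \<theta> \<partial>\<^sub>v\<^sup>2 u
    + (sin \<theta>)\<^sup>-\<^sup>1 \<partial>\<^sub>\<theta> (sin \<theta> \<partial>\<^sub>\<theta> u) = 0\<close>.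
  On the horizon of the extremal metric \<open>\<Delta>\<close> and \<open>\<Delta>'\<close> both vanish, so all that is left is \<open>\<partial>\<^sub>v\<close> of the
  integrand of the charge plus a divergence on the sphere; integration gives conservation. If \<open>u\<close>
  and \<open>\<partial>\<^sub>v u\<close> decay, the charge is the limit of \<open>4 M\<^sup>2 \<integral> \<partial>\<^sub>r u sin \<theta> d\<theta>\<close>.

  A stationary state satisfies \<open>\<partial>\<^sub>r (\<Delta> \<partial>\<^sub>r \<psi>) + (sin \<theta>)\<^sup>-\<^sup>1 \<partial>\<^sub>\<theta> (sin \<theta> \<partial>\<^sub>\<theta> \<psi>) = 0\<close>. For the spherical mean
  \<open>E(r) = \<integral> \<psi>\<^sup>2 sin \<theta> d\<theta>\<close> this makes \<open>\<Delta> E'\<close> nondecreasing; since \<open>\<Delta> E'\<close> vanishes at the horizon,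
  \<open>E\<close> is nondecreasing, and as \<open>E \<ge> 0\<close> tends to \<open>0\<close> at infinity, \<open>E = 0\<close>.\<close>

section \<open>Calculus of smooth functions\<close>

text \<open>The direction comes first so that \<open>dir_deriv w\<close> is an operator on functions
  and can be iterated.\<close>

definition dir_deriv :: "'a::real_normed_vector \<Rightarrow> ('a \<Rightarrow> real) \<Rightarrow> 'a \<Rightarrow> real" where
  "dir_deriv w f x = frechet_derivative f (at x) w"

lemma Ck_on_Suc_iff:
  "Ck_on (Suc k) S f \<longleftrightarrow> (\<forall>x\<in>S. f differentiable (at x)) \<and> (\<forall>w. Ck_on k S (dir_deriv w f))"
  by (simp add: dir_deriv_def[abs_def])

lemma dir_deriv_has_derivative:
  assumes "(f has_derivative f') (at x)"
  shows "dir_deriv w f x = f' w"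
  using frechet_derivative_at[OF assms] by (simp add: dir_deriv_def)

text \<open>Since \<open>S\<close> is open, agreement on \<open>S\<close> is agreement near each of
  its points. Hence the Frechet derivatives agree on \<open>S\<close> too, and the induction passes
  to them.\<close>

lemma Ck_on_cong:
  assumes "open S" "Ck_on k S f" "\<And>x. x \<in> S \<Longrightarrow> f x = g x"
  shows "Ck_on k S g"
  using assms(2,3)
proof (induction k arbitrary: f g)
  case 0
  then show ?case by (metis Ck_on.simps(1) continuous_on_cong)
next
  case (Suc k)
  have g: "(g has_derivative frechet_derivative f (at x)) (at x)" if "x \<in> S" for x
    using Suc.prems that \<open>open S\<close>
    by (auto simp: frechet_derivative_works intro: has_derivative_transform_within_open)
  have "Ck_on k S (dir_deriv w g)" for w
  proof (rule Suc.IH)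
    show "Ck_on k S (dir_deriv w f)" using Suc.prems by (simp add: Ck_on_Suc_iff del: Ck_on.simps)
    show "dir_deriv w f x = dir_deriv w g x" if "x \<in> S" for x
      using dir_deriv_has_derivative[OF g[OF that]] by (simp add: dir_deriv_def)
  qed
  then show ?case using g by (auto simp: Ck_on_Suc_iff differentiable_def simp del: Ck_on.simps)
qed

text \<open>\<open>Ck_on\<close> refers to \<open>frechet_derivative\<close>, which is defined by
  choice. The closure proofs below work with an explicit formula \<open>f'\<close> for the
  derivative instead.\<close>

lemma Ck_on_SucI:
  assumes "open S" "\<And>x. x \<in> S \<Longrightarrow> (f has_derivative f' x) (at x)" "\<And>w. Ck_on k S (\<lambda>x. f' x w)"
  shows "Ck_on (Suc k) S f"
proof -
  have "Ck_on k S (dir_deriv w f)" for w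
    using Ck_on_cong[OF assms(1) assms(3)[of w]] dir_deriv_has_derivative[OF assms(2)] by metis
  then show ?thesis using assms(2) by (auto simp: Ck_on_Suc_iff differentiable_def simp del: Ck_on.simps)
qed

lemma Ck_on_Suc_has_derivative:
  assumes "Ck_on (Suc k) S f" "x \<in> S"
  shows "(f has_derivative (\<lambda>w. dir_deriv w f x)) (at x)"
  using assms by (simp add: dir_deriv_def frechet_derivative_works)

lemma Ck_on_Suc_dir_deriv: "Ck_on (Suc k) S f \<Longrightarrow> Ck_on k S (dir_deriv w f)"
  by (simp add: Ck_on_Suc_iff del: Ck_on.simps)

lemma Ck_on_SucD: "Ck_on (Suc k) S f \<Longrightarrow> Ck_on k S f"
proof (induction k arbitrary: f)
  case 0
  then show ?case
    by (auto intro!: continuous_at_imp_continuous_on differentiable_imp_continuous_within)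
next
  case (Suc k)
  then show ?case
    unfolding Ck_on_Suc_iff[of "Suc k"] Ck_on_Suc_iff[of k] by blast
qed

lemma Ck_on_const: "Ck_on k S (\<lambda>x. c)"
  by (induction k arbitrary: c) simp_all

lemma Ck_on_bounded_linear:
  assumes "open S" "bounded_linear f"
  shows "Ck_on k S f"
proof (cases k)
  case 0
  then show ?thesis using assms by (simp add: linear_continuous_on)
next
  case (Suc m)
  then show ?thesis
    using assms by (auto intro!: Ck_on_SucI bounded_linear_imp_has_derivative Ck_on_const simp del: Ck_on.simps)
qed

lemma Ck_on_add:
  assumes "open S" "Ck_on k S f" "Ck_on k S g"
  shows "Ck_on k S (\<lambda>x. f x + g x)"
  using assms(2,3)
proof (induction k arbitrary: f g)
  case 0
  then show ?case by (auto intro: continuous_intros)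
next
  case (Suc k)
  show ?case
    by (rule Ck_on_SucI[OF \<open>open S\<close> has_derivative_add[OF Suc.prems[THEN Ck_on_Suc_has_derivative]]])
      (auto intro: Suc.IH Suc.prems[THEN Ck_on_Suc_dir_deriv])
qed

lemma Ck_on_sum:
  assumes "open S" "\<And>i. i \<in> I \<Longrightarrow> Ck_on k S (f i)"
  shows "Ck_on k S (\<lambda>x. \<Sum>i\<in>I. f i x)"
  using assms(2)
  by (induction I rule: infinite_finite_induct) (auto intro!: Ck_on_const Ck_on_add[OF \<open>open S\<close>])

lemma Ck_on_mult:
  assumes "open S" "Ck_on k S f" "Ck_on k S g"
  shows "Ck_on k S (\<lambda>x. f x * g x)"
  using assms(2,3)
proof (induction k arbitrary: f g)
  case 0
  then show ?case by (auto intro: continuous_intros)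
next
  case (Suc k)
  show ?case
    by (rule Ck_on_SucI[OF \<open>open S\<close> has_derivative_mult[OF Suc.prems[THEN Ck_on_Suc_has_derivative]]])
      (auto intro!: Ck_on_add[OF \<open>open S\<close>] Suc.IH Suc.prems[THEN Ck_on_Suc_dir_deriv]
        Suc.prems[THEN Ck_on_SucD])
qed

text \<open>\<open>Ck_on\<close> speaks of real-valued functions only, so regularity of the inner
  map is expressed through its components. By the chain rule the derivative is a sum of products of
  functions that are one order less regular.\<close>

lemma Ck_on_compose:
  fixes F :: "'b::euclidean_space \<Rightarrow> real" and X :: "'a::real_normed_vector \<Rightarrow> 'b"
  assumes "open S" "X ` S \<subseteq> W"
    and "Ck_on k W F" "\<And>b. b \<in> Basis \<Longrightarrow> Ck_on k S (\<lambda>x. X x \<bullet> b)"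
  shows "Ck_on k S (\<lambda>x. F (X x))"
  using assms(3,4)
proof (induction k arbitrary: F)
  case 0
  then have "continuous_on S X"
    by (subst continuous_on_componentwise) simp
  then show ?case using 0 assms(2) by (auto intro: continuous_on_compose2)
next
  case (Suc k)
  have XW: "X x \<in> W" if "x \<in> S" for x
    using assms(2) that by blast
  define X' where "X' x w = (\<Sum>b\<in>Basis. dir_deriv w (\<lambda>x. X x \<bullet> b) x *\<^sub>R b)" for x w
  have X: "(X has_derivative X' x) (at x)" if "x \<in> S" for x
  proof -
    have "((\<lambda>x. X x \<bullet> b) has_derivative (\<lambda>w. dir_deriv w (\<lambda>x. X x \<bullet> b) x)) (at x)" if "b \<in> Basis" for b
      using Ck_on_Suc_has_derivative Suc.prems(2)[OF that] \<open>x \<in> S\<close> by blast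
    then show ?thesis
      unfolding X'_def by (subst has_derivative_componentwise_within) simp
  qed
  have F: "((\<lambda>x. F (X x)) has_derivative (\<lambda>w. dir_deriv (X' x w) F (X x))) (at x)" if "x \<in> S" for x
    by (rule has_derivative_compose[OF X[OF that] Ck_on_Suc_has_derivative[OF Suc.prems(1) XW[OF that]]])
  \<comment> \<open>The direction \<open>X' x w\<close> varies with \<open>x\<close>, so the
    induction hypothesis does not apply to it directly. Linearity in the direction reduces it to the
    fixed directions in \<open>Basis\<close>.\<close>
  have F': "dir_deriv (X' x w) F (X x)
      = (\<Sum>b\<in>Basis. dir_deriv w (\<lambda>x. X x \<bullet> b) x * dir_deriv b F (X x))" if "x \<in> S" for x w
  proof -
    have lin: "linear (\<lambda>w. dir_deriv w F (X x))"
      by (rule has_derivative_linear[OF Ck_on_Suc_has_derivative[OF Suc.prems(1) XW[OF that]]])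
    have "dir_deriv (X' x w) F (X x)
        = (\<Sum>b\<in>Basis. dir_deriv (dir_deriv w (\<lambda>x. X x \<bullet> b) x *\<^sub>R b) F (X x))"
      unfolding X'_def by (rule linear_sum[OF lin])
    also have "\<dots> = (\<Sum>b\<in>Basis. dir_deriv w (\<lambda>x. X x \<bullet> b) x * dir_deriv b F (X x))"
      by (rule sum.cong[OF refl]) (simp only: linear_scale[OF lin] real_scaleR_def)
    finally show ?thesis .
  qed
  show ?case
  proof (rule Ck_on_SucI[OF \<open>open S\<close>, where f' = "\<lambda>x w. dir_deriv (X' x w) F (X x)"])
    show "((\<lambda>x. F (X x)) has_derivative (\<lambda>w. dir_deriv (X' x w) F (X x))) (at x)" if "x \<in> S" for x
      using that by (rule F)
    fix w
    have "Ck_on k S (\<lambda>x. \<Sum>b\<in>Basis. dir_deriv w (\<lambda>x. X x \<bullet> b) x * dir_deriv b F (X x))"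
    proof (intro Ck_on_sum Ck_on_mult \<open>open S\<close>)
      show "Ck_on k S (\<lambda>x. dir_deriv b F (X x))" for b
        by (rule Suc.IH[OF Ck_on_Suc_dir_deriv[OF Suc.prems(1)] Ck_on_SucD[OF Suc.prems(2)]])
      show "Ck_on k S (dir_deriv w (\<lambda>x. X x \<bullet> b))" if "b \<in> Basis" for b
        by (rule Ck_on_Suc_dir_deriv[OF Suc.prems(2)[OF that]])
    qed
    then show "Ck_on k S (\<lambda>x. dir_deriv (X' x w) F (X x))"
      by (rule Ck_on_cong[OF \<open>open S\<close>]) (simp only: F')
  qed
qed

lemma Ck_on_sin_cos: "Ck_on k UNIV (sin :: real \<Rightarrow> real)" "Ck_on k UNIV (cos :: real \<Rightarrow> real)"
proof (induction k)
  case 0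
  {
    case 1 show ?case by (auto intro: continuous_intros)
  next
    case 2 show ?case by (auto intro: continuous_intros)
  }
next
  case (Suc k)
  {
    case 1
    show ?case
      by (rule Ck_on_SucI[where f' = "\<lambda>x w. cos x * w"])
        (auto intro!: Ck_on_mult Ck_on_const Suc.IH derivative_eq_intros)
  next
    case 2
    show ?case
    proof (rule Ck_on_SucI)
      show "(cos has_derivative (\<lambda>w. sin x * - w)) (at x)" for x :: real
        by (auto intro!: derivative_eq_intros)
      show "Ck_on k UNIV (\<lambda>x. sin x * - w)" for w :: real
        by (intro Ck_on_mult Ck_on_const Suc.IH open_UNIV)
    qed simp
  }
qed

lemma smooth_on_dir_deriv: "smooth_on S f \<Longrightarrow> smooth_on S (dir_deriv w f)"
  unfolding smooth_on_def by (blast intro: Ck_on_Suc_dir_deriv)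

lemma smooth_on_has_derivative:
  "smooth_on S f \<Longrightarrow> x \<in> S \<Longrightarrow> (f has_derivative (\<lambda>w. dir_deriv w f x)) (at x)"
  unfolding smooth_on_def by (blast intro: Ck_on_Suc_has_derivative)

lemma smooth_on_continuous: "smooth_on S f \<Longrightarrow> continuous_on S f"
  unfolding smooth_on_def by (metis Ck_on.simps(1))

text \<open>The chain rule along a curve. The filter \<open>at s within A\<close> also covers the
  one-sided derivatives needed at \<open>r = M\<close> and at endpoints of a
  \<open>v\<close>-interval.\<close>

lemma smooth_on_curve_has_real_derivative:
  assumes "smooth_on S H" "(c has_vector_derivative c') (at s within A)" "c s \<in> S"
  shows "((\<lambda>s. H (c s)) has_real_derivative dir_deriv c' H (c s)) (at s within A)"
proof -
  have H: "(H has_derivative (\<lambda>w. dir_deriv w H (c s))) (at (c s))"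
    by (rule smooth_on_has_derivative[OF assms(1,3)])
  have "((\<lambda>s. H (c s)) has_derivative (\<lambda>h. dir_deriv (h *\<^sub>R c') H (c s))) (at s within A)"
    by (rule has_derivative_compose[OF assms(2)[unfolded has_vector_derivative_def] H])
  moreover have "(\<lambda>h. dir_deriv (h *\<^sub>R c') H (c s)) = (*) (dir_deriv c' H (c s))"
    using linear_scale[OF has_derivative_linear[OF H]] by (auto simp: mult.commute)
  ultimately show ?thesis by (simp add: has_field_derivative_def)
qed

section \<open>Symmetry of second derivatives\<close>

lemma second_difference_mean_value:
  fixes f :: "'a::real_normed_vector \<Rightarrow> real"
  assumes f: "smooth_on S f" and "0 < s"
    and S: "\<And>\<sigma> \<tau>. 0 \<le> \<sigma> \<Longrightarrow> \<sigma> \<le> s \<Longrightarrow> 0 \<le> \<tau> \<Longrightarrow> \<tau> \<le> s \<Longrightarrow> x + \<sigma> *\<^sub>R w + \<tau> *\<^sub>R z \<in> S"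
  obtains \<sigma> \<tau> where "0 < \<sigma>" "\<sigma> < s" "0 < \<tau>" "\<tau> < s"
    "f (x + s *\<^sub>R w + s *\<^sub>R z) - f (x + s *\<^sub>R w) - f (x + s *\<^sub>R z) + f x
      = s\<^sup>2 * dir_deriv z (dir_deriv w f) (x + \<sigma> *\<^sub>R w + \<tau> *\<^sub>R z)"
proof -
  have line: "((\<lambda>t. g (y + t *\<^sub>R v)) has_real_derivative dir_deriv v g (y + t *\<^sub>R v)) (at t)"
    if "smooth_on S g" "y + t *\<^sub>R v \<in> S" for g y v t
    using that(2) by (intro smooth_on_curve_has_real_derivative[OF that(1)]) (auto intro!: derivative_eq_intros)
  \<comment> \<open>The second difference is the increment over \<open>[0, s]\<close> of
    \<open>f (x + s z + \<sigma> w) - f (x + \<sigma> w)\<close> as a function of \<sigma>. A second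
    mean value argument, now in the direction \<open>z\<close>, is then applied to its
    derivative.\<close>
  have "\<exists>\<sigma>. 0 < \<sigma> \<and> \<sigma> < s \<and>
    (f (x + s *\<^sub>R z + s *\<^sub>R w) - f (x + s *\<^sub>R w)) - (f (x + s *\<^sub>R z + 0 *\<^sub>R w) - f (x + 0 *\<^sub>R w))
      = (s - 0) * (dir_deriv w f (x + s *\<^sub>R z + \<sigma> *\<^sub>R w) - dir_deriv w f (x + \<sigma> *\<^sub>R w))"
  proof (rule MVT2[OF \<open>0 < s\<close>])
    fix \<sigma> assume "0 \<le> \<sigma>" "\<sigma> \<le> s"
    then show "((\<lambda>\<sigma>. f (x + s *\<^sub>R z + \<sigma> *\<^sub>R w) - f (x + \<sigma> *\<^sub>R w)) has_real_derivative
      dir_deriv w f (x + s *\<^sub>R z + \<sigma> *\<^sub>R w) - dir_deriv w f (x + \<sigma> *\<^sub>R w)) (at \<sigma>)"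
      using S[of \<sigma> s] S[of \<sigma> 0] \<open>0 < s\<close> by (intro DERIV_diff line f) (simp_all add: algebra_simps)
  qed
  then obtain \<sigma> where \<sigma>: "0 < \<sigma>" "\<sigma> < s" and
    1: "f (x + s *\<^sub>R w + s *\<^sub>R z) - f (x + s *\<^sub>R w) - f (x + s *\<^sub>R z) + f x
      = s * (dir_deriv w f (x + \<sigma> *\<^sub>R w + s *\<^sub>R z) - dir_deriv w f (x + \<sigma> *\<^sub>R w))"
    by (auto simp: algebra_simps)
  have "\<exists>\<tau>. 0 < \<tau> \<and> \<tau> < s \<and>
    dir_deriv w f (x + \<sigma> *\<^sub>R w + s *\<^sub>R z) - dir_deriv w f (x + \<sigma> *\<^sub>R w + 0 *\<^sub>R z)
      = (s - 0) * dir_deriv z (dir_deriv w f) (x + \<sigma> *\<^sub>R w + \<tau> *\<^sub>R z)"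
    using \<sigma> by (intro MVT2[OF \<open>0 < s\<close>] line smooth_on_dir_deriv f S) auto
  then obtain \<tau> where "0 < \<tau>" "\<tau> < s"
    "dir_deriv w f (x + \<sigma> *\<^sub>R w + s *\<^sub>R z) - dir_deriv w f (x + \<sigma> *\<^sub>R w)
      = s * dir_deriv z (dir_deriv w f) (x + \<sigma> *\<^sub>R w + \<tau> *\<^sub>R z)"
    by auto
  then show thesis using that[OF \<sigma>, of \<tau>] 1 by (simp add: power2_eq_square)
qed

text \<open>The second difference is symmetric in \<open>w\<close> and \<open>z\<close>. So the two
  mixed derivatives take a common value at points arbitrarily close to \<open>x\<close>, and by
  continuity they cannot differ at \<open>x\<close>.\<close>

lemma dir_deriv_commute:
  fixes f :: "'a::real_normed_vector \<Rightarrow> real"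
  assumes f: "smooth_on S f" and "open S" "x \<in> S"
  shows "dir_deriv w (dir_deriv z f) x = dir_deriv z (dir_deriv w f) x"
proof (rule ccontr)
  assume ne: "dir_deriv w (dir_deriv z f) x \<noteq> dir_deriv z (dir_deriv w f) x"
  define A where "A = dir_deriv w (dir_deriv z f)"
  define B where "B = dir_deriv z (dir_deriv w f)"
  define e where "e = \<bar>A x - B x\<bar> / 2"
  have "e > 0" using ne by (simp add: e_def A_def B_def)
  have "isCont A x" "isCont B x"
    using f assms(2,3) unfolding A_def B_def
    by (meson smooth_on_dir_deriv smooth_on_continuous continuous_on_eq_continuous_at)+
  then obtain d1 d2 where d: "d1 > 0" "d2 > 0"
    "\<And>y. dist y x < d1 \<Longrightarrow> dist (A y) (A x) < e" "\<And>y. dist y x < d2 \<Longrightarrow> dist (B y) (B x) < e"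
    using \<open>e > 0\<close> unfolding continuous_at_eps_delta by metis
  obtain d3 where d3: "d3 > 0" "\<And>y. dist y x < d3 \<Longrightarrow> y \<in> S"
    using assms(2,3) unfolding open_dist by blast
  define d where "d = Min {d1, d2, d3}"
  define N where "N = norm w + norm z + 1"
  \<comment> \<open>With this size the whole parallelogram spanned by \<open>s w\<close> and
    \<open>s z\<close> stays within \<open>d / 2\<close> of \<open>x\<close>. The summand 1 in
    \<open>N\<close> avoids division by zero when both directions vanish.\<close>
  define s where "s = d / (2 * N)"
  have "d > 0" using d d3 by (simp add: d_def)
  have "N > 0" by (simp add: N_def add_nonneg_pos)
  with \<open>d > 0\<close> have "s > 0" by (simp add: s_def)
  have near: "dist (x + \<sigma> *\<^sub>R u + \<tau> *\<^sub>R v) x < d"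
    if "0 \<le> \<sigma>" "\<sigma> \<le> s" "0 \<le> \<tau>" "\<tau> \<le> s" "norm u + norm v = norm w + norm z" for \<sigma> \<tau> u v
  proof -
    have "dist (x + \<sigma> *\<^sub>R u + \<tau> *\<^sub>R v) x = norm (\<sigma> *\<^sub>R u + \<tau> *\<^sub>R v)"
      by (simp add: dist_norm)
    also have "\<dots> \<le> \<sigma> * norm u + \<tau> * norm v"
      using that norm_triangle_ineq[of "\<sigma> *\<^sub>R u" "\<tau> *\<^sub>R v"] by simp
    also have "\<dots> \<le> s * norm u + s * norm v"
      using that by (intro add_mono mult_right_mono) auto
    also have "\<dots> = s * (norm w + norm z)"
      using that by (simp flip: distrib_left)
    also have "\<dots> \<le> s * N"
      using \<open>s > 0\<close> by (simp add: N_def)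
    also have "\<dots> = d / 2"
      using \<open>N > 0\<close> by (simp add: s_def)
    also have "\<dots> < d" using \<open>d > 0\<close> by simp
    finally show ?thesis .
  qed
  have inS: "x + \<sigma> *\<^sub>R u + \<tau> *\<^sub>R v \<in> S"
    if "0 \<le> \<sigma>" "\<sigma> \<le> s" "0 \<le> \<tau>" "\<tau> \<le> s" "norm u + norm v = norm w + norm z" for \<sigma> \<tau> u v
    using near[OF that] d3(2) by (simp add: d_def)
  obtain \<sigma> \<tau> where 1: "0 < \<sigma>" "\<sigma> < s" "0 < \<tau>" "\<tau> < s"
    "f (x + s *\<^sub>R w + s *\<^sub>R z) - f (x + s *\<^sub>R w) - f (x + s *\<^sub>R z) + f x
      = s\<^sup>2 * B (x + \<sigma> *\<^sub>R w + \<tau> *\<^sub>R z)"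
    using second_difference_mean_value[OF f \<open>s > 0\<close>, of x w z] inS unfolding B_def by metis
  obtain \<sigma>' \<tau>' where 2: "0 < \<sigma>'" "\<sigma>' < s" "0 < \<tau>'" "\<tau>' < s"
    "f (x + s *\<^sub>R z + s *\<^sub>R w) - f (x + s *\<^sub>R z) - f (x + s *\<^sub>R w) + f x
      = s\<^sup>2 * A (x + \<sigma>' *\<^sub>R z + \<tau>' *\<^sub>R w)"
    using second_difference_mean_value[OF f \<open>s > 0\<close>, of x z w] inS[of _ _ z w] unfolding A_def
    by (metis add.commute)
  have "s\<^sup>2 * A (x + \<sigma>' *\<^sub>R z + \<tau>' *\<^sub>R w) = s\<^sup>2 * B (x + \<sigma> *\<^sub>R w + \<tau> *\<^sub>R z)"
    using 1(5) 2(5) unfolding add.assoc[of x] add.commute[of "s *\<^sub>R z"] by linarith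
  then have "A (x + \<sigma>' *\<^sub>R z + \<tau>' *\<^sub>R w) = B (x + \<sigma> *\<^sub>R w + \<tau> *\<^sub>R z)"
    using \<open>s > 0\<close> unfolding mult_cancel_left by simp
  moreover have "dist (A (x + \<sigma>' *\<^sub>R z + \<tau>' *\<^sub>R w)) (A x) < e"
    using near[of \<sigma>' \<tau>' z w] 2 by (intro d) (auto simp: d_def)
  moreover have "dist (B (x + \<sigma> *\<^sub>R w + \<tau> *\<^sub>R z)) (B x) < e"
    using near[of \<sigma> \<tau> w z] 1 by (intro d) (auto simp: d_def)
  ultimately have "\<bar>A x - B x\<bar> < 2 * e" unfolding dist_real_def by linarith
  then show False by (simp add: e_def)
qed

section \<open>Determinant and inverse of the Kerr metric\<close>

text \<open>The sum over permutations is unfolded by peeling off one index at a time.\<close>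

lemma det_4:
  "det (A::'a::comm_ring_1^4^4) =
    A$1$1 * (A$2$2 * (A$3$3 * A$4$4 - A$3$4 * A$4$3) - A$2$3 * (A$3$2 * A$4$4 - A$3$4 * A$4$2)
      + A$2$4 * (A$3$2 * A$4$3 - A$3$3 * A$4$2)) -
    A$1$2 * (A$2$1 * (A$3$3 * A$4$4 - A$3$4 * A$4$3) - A$2$3 * (A$3$1 * A$4$4 - A$3$4 * A$4$1)
      + A$2$4 * (A$3$1 * A$4$3 - A$3$3 * A$4$1)) +
    A$1$3 * (A$2$1 * (A$3$2 * A$4$4 - A$3$4 * A$4$2) - A$2$2 * (A$3$1 * A$4$4 - A$3$4 * A$4$1)
      + A$2$4 * (A$3$1 * A$4$2 - A$3$2 * A$4$1)) -
    A$1$4 * (A$2$1 * (A$3$2 * A$4$3 - A$3$3 * A$4$2) - A$2$2 * (A$3$1 * A$4$3 - A$3$3 * A$4$1)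
      + A$2$3 * (A$3$1 * A$4$2 - A$3$2 * A$4$1))"
proof -
  have 1: "finite {2::4, 3, 4}" "1 \<notin> {2::4, 3, 4}" by auto
  have 2: "finite {3::4, 4}" "2 \<notin> {3::4, 4}" by auto
  have 3: "finite {4::4}" "3 \<notin> {4::4}" by auto
  show ?thesis
    unfolding det_def UNIV_4 sum_over_permutations_insert[OF 1] sum_over_permutations_insert[OF 2]
      sum_over_permutations_insert[OF 3] permutes_sing
    by (simp add: sign_swap_id permutation_swap_id permutation_compose sign_compose sign_id swap_id_eq)
      (simp add: algebra_simps)
qed

lemma Kerr_rho2_eq: "Kerr_rho2 a r \<theta> = r\<^sup>2 + a\<^sup>2 - a\<^sup>2 * (sin \<theta>)\<^sup>2"
  by (simp add: Kerr_rho2_def cos_squared_eq algebra_simps)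

lemma Kerr_rho2_pos: "r > 0 \<Longrightarrow> Kerr_rho2 a r \<theta> > 0"
  by (simp add: Kerr_rho2_def add_pos_nonneg)

lemma Kerr_metric_nth:
  fixes p :: "real^4"
  defines "r \<equiv> p$2" and "\<theta> \<equiv> p$3"
  shows "Kerr_metric M a p $ i $ j = (let \<Delta> = Kerr_Delta M r; \<Sigma> = Kerr_rho2 a r \<theta>; s = (sin \<theta>)\<^sup>2 in
    if i = 1 \<and> j = 1 then (a\<^sup>2 * s - \<Delta>) / \<Sigma>
    else if i = 4 \<and> j = 4 then s * ((r\<^sup>2 + a\<^sup>2)\<^sup>2 - \<Delta> * a\<^sup>2 * s) / \<Sigma>
    else if i = 1 \<and> j = 4 \<or> i = 4 \<and> j = 1 then a * s * (\<Delta> - (r\<^sup>2 + a\<^sup>2)) / \<Sigma>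
    else if i = 2 \<and> j = 2 then \<Sigma> / \<Delta>
    else if i = 3 \<and> j = 3 then \<Sigma>
    else 0)"
  using exhaust_4[of i] exhaust_4[of j]
  by (auto simp: Kerr_metric_def covector_square_def Let_def axis_def r_def[symmetric] \<theta>_def[symmetric]
      diff_divide_distrib add_divide_distrib power2_eq_square algebra_simps)

definition Kerr_inverse :: "real \<Rightarrow> real \<Rightarrow> real^4 \<Rightarrow> real^4^4" where
  "Kerr_inverse M a p = (let r = p$2; \<theta> = p$3; \<Delta> = Kerr_Delta M r; \<Sigma> = Kerr_rho2 a r \<theta>; s = (sin \<theta>)\<^sup>2 in
    (\<chi> i j.
      if i = 1 \<and> j = 1 then (a\<^sup>2 * s - (r\<^sup>2 + a\<^sup>2)\<^sup>2 / \<Delta>) / \<Sigma>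
      else if i = 4 \<and> j = 4 then (1 / s - a\<^sup>2 / \<Delta>) / \<Sigma>
      else if i = 1 \<and> j = 4 \<or> i = 4 \<and> j = 1 then (a - a * (r\<^sup>2 + a\<^sup>2) / \<Delta>) / \<Sigma>
      else if i = 2 \<and> j = 2 then \<Delta> / \<Sigma>
      else if i = 3 \<and> j = 3 then 1 / \<Sigma>
      else 0))"

lemma matrix_inv_eqI:
  fixes A B :: "real^'n^'n"
  assumes "A ** B = mat 1"
  shows "matrix_inv A = B"
proof -
  have "\<exists>C. A ** C = mat 1 \<and> C ** A = mat 1"
    using assms matrix_left_right_inverse[of A B] by blast
  then have "matrix_inv A ** A = mat 1"
    unfolding matrix_inv_def by (rule someI2_ex) simp
  then show ?thesis
    by (metis assms matrix_mul_assoc matrix_mul_lid matrix_mul_rid)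
qed

context
  fixes M a :: real and p :: "real^4"
  assumes p: "M > 0" "p$2 > M" "sin (p$3) \<noteq> 0"
begin

lemma det_Kerr_metric:
  "det (Kerr_metric M a p) = - ((Kerr_rho2 a (p$2) (p$3))\<^sup>2 * (sin (p$3))\<^sup>2)"
  and matrix_inv_Kerr_metric: "matrix_inv (Kerr_metric M a p) = Kerr_inverse M a p"
proof -
  define \<Delta> \<Sigma> s where "\<Delta> = Kerr_Delta M (p$2)" and "\<Sigma> = Kerr_rho2 a (p$2) (p$3)" and "s = (sin (p$3))\<^sup>2"
  note defs = \<Delta>_def \<Sigma>_def s_def
  have pos: "\<Delta> > 0" "\<Sigma> > 0" "s > 0"
    using p by (auto simp: defs Kerr_Delta_def Kerr_rho2_pos)
  \<comment> \<open>This relation removes \<open>r\<close> from the entries. They become rational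
    functions of \<open>a\<close>, \<Delta>, \<Sigma> and \<open>s\<close>, so the identities below
    are purely algebraic and need only that the denominators are nonzero.\<close>
  have r2: "(p$2)\<^sup>2 + a\<^sup>2 = \<Sigma> + a\<^sup>2 * s" by (simp add: defs Kerr_rho2_eq)
  define g11 g14 g44 where "g11 = (a\<^sup>2 * s - \<Delta>) / \<Sigma>"
    and "g14 = a * s * (\<Delta> - (\<Sigma> + a\<^sup>2 * s)) / \<Sigma>"
    and "g44 = s * ((\<Sigma> + a\<^sup>2 * s)\<^sup>2 - \<Delta> * a\<^sup>2 * s) / \<Sigma>"
  define h11 h14 h44 where "h11 = (a\<^sup>2 * s - (\<Sigma> + a\<^sup>2 * s)\<^sup>2 / \<Delta>) / \<Sigma>"
    and "h14 = (a - a * (\<Sigma> + a\<^sup>2 * s) / \<Delta>) / \<Sigma>"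
    and "h44 = (1 / s - a\<^sup>2 / \<Delta>) / \<Sigma>"
  have g: "Kerr_metric M a p $ i $ j =
      (if i = 1 \<and> j = 1 then g11 else if i = 4 \<and> j = 4 then g44
       else if i = 1 \<and> j = 4 \<or> i = 4 \<and> j = 1 then g14
       else if i = 2 \<and> j = 2 then \<Sigma> / \<Delta> else if i = 3 \<and> j = 3 then \<Sigma> else 0)" for i j
    unfolding Kerr_metric_nth Let_def g11_def g14_def g44_def defs[symmetric] r2 by simp
  have h: "Kerr_inverse M a p $ i $ j =
      (if i = 1 \<and> j = 1 then h11 else if i = 4 \<and> j = 4 then h44
       else if i = 1 \<and> j = 4 \<or> i = 4 \<and> j = 1 then h14
       else if i = 2 \<and> j = 2 then \<Delta> / \<Sigma> else if i = 3 \<and> j = 3 then 1 / \<Sigma> else 0)" for i j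
    unfolding Kerr_inverse_def Let_def h11_def h14_def h44_def defs[symmetric] r2 by simp
  \<comment> \<open>The t, \<phi> block has determinant \<open>- \<Delta> s\<close>. Its factor
    \<Delta> cancels the one in the denominator of the radial entry, so the full determinant stays
    bounded away from zero as \<open>r\<close> tends to \<open>M\<close> off the axis.\<close>
  have "g11 * g44 - g14 * g14 = - (\<Delta> * s)"
    unfolding g11_def g14_def g44_def using pos by (simp add: field_simps) algebra
  then have "\<Sigma> / \<Delta> * \<Sigma> * (g11 * g44 - g14 * g14) = \<Sigma> / \<Delta> * \<Sigma> * (- (\<Delta> * s))"
    by (rule arg_cong)
  also have "\<dots> = - (\<Sigma>\<^sup>2 * s)"
    using pos by (simp add: power2_eq_square)
  finally have "\<Sigma> / \<Delta> * \<Sigma> * (g11 * g44 - g14 * g14) = - (\<Sigma>\<^sup>2 * s)" .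
  then show "det (Kerr_metric M a p) = - ((Kerr_rho2 a (p$2) (p$3))\<^sup>2 * (sin (p$3))\<^sup>2)"
    by (simp add: det_4 g algebra_simps flip: defs)
  have "g11 * h11 + g14 * h14 = 1" "g11 * h14 + g14 * h44 = 0"
      "g14 * h11 + g44 * h14 = 0" "g14 * h14 + g44 * h44 = 1"
    unfolding g11_def g14_def g44_def h11_def h14_def h44_def
    using pos by (simp_all add: field_simps) algebra+
  then have "Kerr_metric M a p ** Kerr_inverse M a p = mat 1"
    using pos by (simp add: vec_eq_iff forall_4 matrix_matrix_mult_def sum_4 g h mat_def)
  then show "matrix_inv (Kerr_metric M a p) = Kerr_inverse M a p"
    by (rule matrix_inv_eqI)
qed

end

section \<open>The wave operator in ingoing coordinates\<close>

lemma partial_cong: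
  assumes "\<forall>\<^sub>F q in nhds p. f q = g q"
  shows "partial i f p = partial i g p"
proof -
  have "((\<lambda>s. p + s *\<^sub>R axis i 1) \<longlongrightarrow> p) (nhds 0)"
    by (auto intro!: tendsto_eq_intros filterlim_ident)
  then show ?thesis
    unfolding partial_def
    by (intro deriv_cong_ev eventually_compose_filterlim[OF assms]) simp_all
qed

lemma partial_eqI:
  "((\<lambda>s. f (p + s *\<^sub>R axis i 1)) has_real_derivative d) (at 0) \<Longrightarrow> partial i f p = d"
  unfolding partial_def by (rule DERIV_imp_deriv)

text \<open>The passage from Boyer--Lindquist to ingoing coordinates with r, \<theta> and the angle
  kept as coordinates. It separates the part of \<open>ingoing_point\<close> that is singular at the
  horizon from the spherical chart.\<close>

definition ingoing_shift :: "(real \<Rightarrow> real) \<Rightarrow> (real \<Rightarrow> real) \<Rightarrow> real^4 \<Rightarrow> real^4" where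
  "ingoing_shift rs \<phi>s q = q + rs (q$2) *\<^sub>R axis 1 1 + \<phi>s (q$2) *\<^sub>R axis 4 1"

lemma ingoing_shift_nth [simp]:
  "ingoing_shift rs \<phi>s q $ 1 = q$1 + rs (q$2)"
  "ingoing_shift rs \<phi>s q $ 2 = q$2"
  "ingoing_shift rs \<phi>s q $ 3 = q$3"
  "ingoing_shift rs \<phi>s q $ 4 = q$4 + \<phi>s (q$2)"
  by (simp_all add: ingoing_shift_def axis_def)

text \<open>The Boyer--Lindquist coordinate fields in ingoing terms: only the radial one changes. It
  gains \<open>(r^2 + a^2) / \<Delta>\<close> times \<partial>v and \<open>a / \<Delta>\<close>
  times \<partial>\<phi>.\<close>

lemma ingoing_shift_has_vector_derivative:
  assumes rs: "tortoise M a rs" and \<phi>s: "angular_shift M a \<phi>s" and "M < q$2"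
  shows "((\<lambda>s. ingoing_shift rs \<phi>s (q + s *\<^sub>R axis i 1)) has_vector_derivative
     axis i 1 + (if i = 2 then ((q$2)\<^sup>2 + a\<^sup>2) / Kerr_Delta M (q$2) else 0) *\<^sub>R axis 1 1
       + (if i = 2 then a / Kerr_Delta M (q$2) else 0) *\<^sub>R axis 4 1) (at 0)"
proof -
  have r: "((\<lambda>s. (q + s *\<^sub>R axis i 1)$2) has_real_derivative (if i = 2 then 1 else 0)) (at 0)"
    by (auto simp: axis_def intro!: derivative_eq_intros)
  have "(rs has_real_derivative ((q$2)\<^sup>2 + a\<^sup>2) / Kerr_Delta M (q$2)) (at ((q + 0 *\<^sub>R axis i 1)$2))"
    "(\<phi>s has_real_derivative a / Kerr_Delta M (q$2)) (at ((q + 0 *\<^sub>R axis i 1)$2))"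
    using assms unfolding tortoise_def angular_shift_def by auto
  from this[THEN DERIV_chain2[OF _ r]]
  have 1: "((\<lambda>s. rs ((q + s *\<^sub>R axis i 1)$2)) has_real_derivative
      (if i = 2 then ((q$2)\<^sup>2 + a\<^sup>2) / Kerr_Delta M (q$2) else 0)) (at 0)"
    "((\<lambda>s. \<phi>s ((q + s *\<^sub>R axis i 1)$2)) has_real_derivative
      (if i = 2 then a / Kerr_Delta M (q$2) else 0)) (at 0)"
    by (auto split: if_splits cong: if_cong)
  show ?thesis
    unfolding ingoing_shift_def
  proof (intro has_vector_derivative_add)
    show "((\<lambda>s. q + s *\<^sub>R axis i 1) has_vector_derivative axis i 1) (at 0)"
      by (auto intro!: derivative_eq_intros)
  qed (rule has_vector_derivative_scaleR[OF 1(1) has_vector_derivative_const, simplified scaleR_zero_right add_0_left]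
      has_vector_derivative_scaleR[OF 1(2) has_vector_derivative_const, simplified scaleR_zero_right add_0_left])+
qed

lemma continuous_on_ingoing_shift:
  assumes "tortoise M a rs" "angular_shift M a \<phi>s"
  shows "continuous_on {q. M < q$2} (ingoing_shift rs \<phi>s)"
proof -
  have "continuous_on {M<..} rs" "continuous_on {M<..} \<phi>s"
    using assms unfolding tortoise_def angular_shift_def
    by (auto intro!: continuous_at_imp_continuous_on dest: DERIV_isCont)
  then have "continuous_on {q::real^4. M < q$2} (\<lambda>q. rs (q$2))"
    "continuous_on {q::real^4. M < q$2} (\<lambda>q. \<phi>s (q$2))"
    by (auto elim!: continuous_on_compose2 intro!: continuous_intros)
  then show ?thesis
    unfolding ingoing_shift_def by (intro continuous_intros)
qed

lemma dir_deriv_add_scaleR: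
  assumes "smooth_on S H" "x \<in> S"
  shows "dir_deriv (u + c *\<^sub>R v + d *\<^sub>R w) H x = dir_deriv u H x + c * dir_deriv v H x + d * dir_deriv w H x"
proof -
  have lin: "linear (\<lambda>w. dir_deriv w H x)"
    by (rule has_derivative_linear[OF smooth_on_has_derivative[OF assms]])
  show ?thesis
    by (simp only: linear_add[OF lin] linear_scale[OF lin] real_scaleR_def)
qed


abbreviation coord_deriv :: "'n::finite \<Rightarrow> (real^'n \<Rightarrow> real) \<Rightarrow> real^'n \<Rightarrow> real" where
  "coord_deriv i \<equiv> dir_deriv (axis i 1)"

text \<open>This is \<open>\<rho>\<^sup>2 sin \<theta> \<box>U\<close> for axisymmetric \<open>U\<close>; unlike \<open>\<box>\<close> in Boyer--Lindquist coordinates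
  it has no singular coefficients at the horizon.\<close>

definition ingoing_wave :: "real \<Rightarrow> real \<Rightarrow> (real^4 \<Rightarrow> real) \<Rightarrow> real^4 \<Rightarrow> real" where
  "ingoing_wave M a U x = (let r = x$2; \<theta> = x$3; D = coord_deriv in
     sin \<theta> * (Kerr_Delta M r * D 2 (D 2 U) x + 2 * (r - M) * D 2 U x
       + 2 * (r\<^sup>2 + a\<^sup>2) * D 1 (D 2 U) x + 2 * r * D 1 U x
       + a\<^sup>2 * (sin \<theta>)\<^sup>2 * D 1 (D 1 U) x + D 3 (D 3 U) x)
     + cos \<theta> * D 3 U x)"

text \<open>After multiplication by \<open>sqrt \<bar>det g\<bar>\<close>, which equals
  \<rho>-squared times sin \<theta>, the operator is in divergence form. Its terms singular at the
  horizon come with the second v-derivative, once from the tt entry of the inverse metric and once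
  from the radial part, with opposite signs.\<close>

lemma wave_operator_ingoing:
  fixes U :: "real^4 \<Rightarrow> real" and p :: "real^4" and M a :: real and rs \<phi>s :: "real \<Rightarrow> real"
  defines "\<kappa> \<equiv> ingoing_shift rs \<phi>s"
    and "\<Delta> \<equiv> Kerr_Delta M (p$2)" and "r \<equiv> p$2" and "\<theta> \<equiv> p$3"
  assumes "M > 0" and rs: "tortoise M a rs" and \<phi>s: "angular_shift M a \<phi>s"
    and S: "open S" "\<And>x. x \<in> S \<Longrightarrow> M < x$2 \<and> 0 < x$3 \<and> x$3 < pi"
    and U: "smooth_on S U" "\<And>x. x \<in> S \<Longrightarrow> coord_deriv 4 U x = 0"
    and p: "\<kappa> p \<in> S" and f: "\<And>q. \<kappa> q \<in> S \<Longrightarrow> f q = U (\<kappa> q)"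
  shows "Kerr_rho2 a r \<theta> * sin \<theta> * wave_operator (Kerr_metric M a) f p = ingoing_wave M a U (\<kappa> p)"
proof -
  define D :: "4 \<Rightarrow> (real^4 \<Rightarrow> real) \<Rightarrow> real^4 \<Rightarrow> real" where "D i = coord_deriv i" for i
  define O' where "O' = {q. \<kappa> q \<in> S}"
  have "open O'"
  proof -
    have "open {q::real^4. M < q$2}" by (intro open_Collect_less continuous_intros)
    then have "open ({q. M < q$2} \<inter> \<kappa> -` S)"
      unfolding \<kappa>_def by (intro continuous_open_preimage continuous_on_ingoing_shift[OF rs \<phi>s] S(1))
    moreover have "{q. M < q$2} \<inter> \<kappa> -` S = O'"
      using S(2) by (fastforce simp: O'_def \<kappa>_def)
    ultimately show ?thesis by simp
  qed
  have range: "M < q$2" "0 < q$3" "q$3 < pi" if "q \<in> O'" for q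
    using S(2)[of "\<kappa> q"] that by (simp_all add: O'_def \<kappa>_def)
  have "p \<in> O'" using p by (simp add: O'_def)
  note p_range = range[OF this, folded r_def \<theta>_def]
  have DU: "smooth_on S (D i H)" if "smooth_on S H" for i H
    unfolding D_def by (rule smooth_on_dir_deriv[OF that])
  have lift: "((\<lambda>s. H (\<kappa> (q + s *\<^sub>R axis i 1))) has_real_derivative
      D i H (\<kappa> q) + (if i = 2 then ((q$2)\<^sup>2 + a\<^sup>2) / Kerr_Delta M (q$2) else 0) * D 1 H (\<kappa> q)
        + (if i = 2 then a / Kerr_Delta M (q$2) else 0) * D 4 H (\<kappa> q)) (at 0)"
    if "smooth_on S H" "q \<in> O'" for H q i
  proof -
    have q: "\<kappa> q \<in> S" using that by (simp add: O'_def)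
    have "((\<lambda>s. H (\<kappa> (q + s *\<^sub>R axis i 1))) has_real_derivative
      dir_deriv (axis i 1 + (if i = 2 then ((q$2)\<^sup>2 + a\<^sup>2) / Kerr_Delta M (q$2) else 0) *\<^sub>R axis 1 1
       + (if i = 2 then a / Kerr_Delta M (q$2) else 0) *\<^sub>R axis 4 1) H (\<kappa> (q + 0 *\<^sub>R axis i 1))) (at 0)"
      using q unfolding \<kappa>_def
      by (intro smooth_on_curve_has_real_derivative[OF that(1)]
          ingoing_shift_has_vector_derivative[OF rs \<phi>s range(1)[OF that(2)]]) simp
    then show ?thesis
      unfolding D_def scaleR_zero_left add_0_right dir_deriv_add_scaleR[OF that(1) q] .
  qed
  have partial_f: "partial i f q = D i U (\<kappa> q)
      + (if i = 2 then ((q$2)\<^sup>2 + a\<^sup>2) / Kerr_Delta M (q$2) else 0) * D 1 U (\<kappa> q)" if "q \<in> O'" for q i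
  proof -
    have "\<forall>\<^sub>F q' in nhds q. f q' = U (\<kappa> q')"
      using eventually_nhds_in_open[OF \<open>open O'\<close> that] by eventually_elim (simp add: O'_def f)
    then have "partial i f q = partial i (\<lambda>q. U (\<kappa> q)) q"
      by (rule partial_cong)
    also have "\<dots> = D i U (\<kappa> q)
        + (if i = 2 then ((q$2)\<^sup>2 + a\<^sup>2) / Kerr_Delta M (q$2) else 0) * D 1 U (\<kappa> q)
        + (if i = 2 then a / Kerr_Delta M (q$2) else 0) * D 4 U (\<kappa> q)"
      by (rule partial_eqI) (rule lift[OF U(1) that])
    also have "D 4 U (\<kappa> q) = 0" using that by (intro U(2)[folded D_def]) (simp add: O'_def)
    finally show ?thesis by simp
  qed
  \<comment> \<open>Axisymmetry is first-order information about \<open>U\<close>. Commuting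
    derivatives extends it to \<open>D j U\<close>.\<close>
  have D4: "D 4 (D j U) (\<kappa> p) = 0" for j
  proof -
    have "D 4 (D j U) (\<kappa> p) = D j (D 4 U) (\<kappa> p)"
      unfolding D_def by (rule dir_deriv_commute[OF U(1) S(1) p])
    moreover have "(D 4 U has_derivative (\<lambda>_. 0)) (at (\<kappa> p))"
      by (rule has_derivative_transform_within_open[OF has_derivative_const S(1) p]) (simp add: U(2)[folded D_def])
    ultimately show ?thesis using dir_deriv_has_derivative unfolding D_def by metis
  qed
  define C where "C i j q = sqrt \<bar>det (Kerr_metric M a q)\<bar> * matrix_inv (Kerr_metric M a q) $ i $ j" for i j q
  have C: "C i j q = sin (q$3) *
     (if i = 1 \<and> j = 1 then a\<^sup>2 * (sin (q$3))\<^sup>2 - ((q$2)\<^sup>2 + a\<^sup>2)\<^sup>2 / Kerr_Delta M (q$2)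
      else if i = 4 \<and> j = 4 then 1 / (sin (q$3))\<^sup>2 - a\<^sup>2 / Kerr_Delta M (q$2)
      else if i = 1 \<and> j = 4 \<or> i = 4 \<and> j = 1 then a - a * ((q$2)\<^sup>2 + a\<^sup>2) / Kerr_Delta M (q$2)
      else if i = 2 \<and> j = 2 then Kerr_Delta M (q$2)
      else if i = 3 \<and> j = 3 then 1
      else 0)" if "q \<in> O'" for i j q
  proof -
    have "sin (q$3) > 0" using range[OF that] by (simp add: sin_gt_zero)
    moreover have "Kerr_rho2 a (q$2) (q$3) > 0" using range(1)[OF that] \<open>M > 0\<close> by (intro Kerr_rho2_pos) simp
    ultimately show ?thesis
      unfolding C_def using \<open>M > 0\<close> range(1)[OF that]
      by (simp add: det_Kerr_metric matrix_inv_Kerr_metric abs_mult real_sqrt_mult Kerr_inverse_def Let_def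
          flip: power_mult_distrib)
  qed
  have cong: "partial i (\<lambda>q. C i j q * partial j f q) p = partial i h p"
    if "\<And>q. q \<in> O' \<Longrightarrow> C i j q * partial j f q = h q" for i j h
    by (rule partial_cong, rule eventually_mono[OF eventually_nhds_in_open[OF \<open>open O'\<close> \<open>p \<in> O'\<close>]])
      (rule that)
  have zero: "partial i (\<lambda>q. C i j q * partial j f q) p = 0"
    if "\<And>q. q \<in> O' \<Longrightarrow> C i j q * partial j f q = 0" for i j
    using cong[of i j "\<lambda>_. 0"] that partial_eqI[of "\<lambda>_. 0" p i 0] by simp
  have \<Delta>: "\<Delta> > 0" using p_range by (simp add: \<Delta>_def Kerr_Delta_def r_def)
  have T11: "partial 1 (\<lambda>q. C 1 1 q * partial 1 f q) p
    = sin \<theta> * (a\<^sup>2 * (sin \<theta>)\<^sup>2 - (r\<^sup>2 + a\<^sup>2)\<^sup>2 / \<Delta>) * D 1 (D 1 U) (\<kappa> p)"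
  proof (rule trans[OF cong])
    show "partial 1 (\<lambda>q. sin (q$3) * (a\<^sup>2 * (sin (q$3))\<^sup>2 - ((q$2)\<^sup>2 + a\<^sup>2)\<^sup>2 / Kerr_Delta M (q$2)) * D 1 U (\<kappa> q)) p
      = sin \<theta> * (a\<^sup>2 * (sin \<theta>)\<^sup>2 - (r\<^sup>2 + a\<^sup>2)\<^sup>2 / \<Delta>) * D 1 (D 1 U) (\<kappa> p)"
      using DERIV_cmult[OF lift[OF DU[OF U(1)] \<open>p \<in> O'\<close>, of 1 1],
          of "sin \<theta> * (a\<^sup>2 * (sin \<theta>)\<^sup>2 - (r\<^sup>2 + a\<^sup>2)\<^sup>2 / \<Delta>)"]
      by (intro partial_eqI) (simp add: axis_def r_def \<theta>_def \<Delta>_def)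
  qed (simp add: C partial_f)
  \<comment> \<open>The coefficient does not depend on \<phi>, and neither does the v-derivative of
    \<open>U\<close>.\<close>
  have T41: "partial 4 (\<lambda>q. C 4 1 q * partial 1 f q) p = 0"
  proof (rule trans[OF cong])
    show "partial 4 (\<lambda>q. sin (q$3) * (a - a * ((q$2)\<^sup>2 + a\<^sup>2) / Kerr_Delta M (q$2)) * D 1 U (\<kappa> q)) p = 0"
      using DERIV_cmult[OF lift[OF DU[OF U(1)] \<open>p \<in> O'\<close>, of 1 4],
          of "sin \<theta> * (a - a * (r\<^sup>2 + a\<^sup>2) / \<Delta>)"]
      by (intro partial_eqI) (simp add: axis_def r_def \<theta>_def \<Delta>_def D4)
  qed (simp add: C partial_f)
  have T33: "partial 3 (\<lambda>q. C 3 3 q * partial 3 f q) p = sin \<theta> * D 3 (D 3 U) (\<kappa> p) + cos \<theta> * D 3 U (\<kappa> p)"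
  proof (rule trans[OF cong])
    have "((\<lambda>s. sin (\<theta> + s)) has_real_derivative cos \<theta>) (at 0)"
      by (auto intro!: derivative_eq_intros)
    from DERIV_mult[OF this lift[OF DU[OF U(1)] \<open>p \<in> O'\<close>, of 3 3]]
    show "partial 3 (\<lambda>q. sin (q$3) * D 3 U (\<kappa> q)) p = sin \<theta> * D 3 (D 3 U) (\<kappa> p) + cos \<theta> * D 3 U (\<kappa> p)"
      by (intro partial_eqI) (simp add: axis_def \<theta>_def algebra_simps)
  qed (simp add: C partial_f)
  \<comment> \<open>Multiplying the Boyer--Lindquist radial derivative by \<Delta> clears its
    denominator. A factor \<open>1 / \<Delta>\<close> reappears only through the second
    differentiation.\<close>
  have T22: "partial 2 (\<lambda>q. C 2 2 q * partial 2 f q) p = sin \<theta> *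
      (2 * r * D 1 U (\<kappa> p) + (r\<^sup>2 + a\<^sup>2) * (D 2 (D 1 U) (\<kappa> p) + (r\<^sup>2 + a\<^sup>2) / \<Delta> * D 1 (D 1 U) (\<kappa> p))
        + 2 * (r - M) * D 2 U (\<kappa> p) + \<Delta> * (D 2 (D 2 U) (\<kappa> p) + (r\<^sup>2 + a\<^sup>2) / \<Delta> * D 1 (D 2 U) (\<kappa> p)))"
  proof (rule trans[OF cong])
    have 1: "((\<lambda>s. (r + s)\<^sup>2 + a\<^sup>2) has_real_derivative 2 * r) (at 0)"
      "((\<lambda>s. Kerr_Delta M (r + s)) has_real_derivative 2 * (r - M)) (at 0)"
      unfolding Kerr_Delta_def by (auto intro!: derivative_eq_intros)
    from DERIV_cmult[OF DERIV_add[OF DERIV_mult[OF 1(1) lift[OF DU[OF U(1)] \<open>p \<in> O'\<close>, of 1 2]]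
          DERIV_mult[OF 1(2) lift[OF DU[OF U(1)] \<open>p \<in> O'\<close>, of 2 2]]], of "sin \<theta>"]
    show "partial 2 (\<lambda>q. sin (q$3) * (((q$2)\<^sup>2 + a\<^sup>2) * D 1 U (\<kappa> q) + Kerr_Delta M (q$2) * D 2 U (\<kappa> q))) p
      = sin \<theta> *
      (2 * r * D 1 U (\<kappa> p) + (r\<^sup>2 + a\<^sup>2) * (D 2 (D 1 U) (\<kappa> p) + (r\<^sup>2 + a\<^sup>2) / \<Delta> * D 1 (D 1 U) (\<kappa> p))
        + 2 * (r - M) * D 2 U (\<kappa> p) + \<Delta> * (D 2 (D 2 U) (\<kappa> p) + (r\<^sup>2 + a\<^sup>2) / \<Delta> * D 1 (D 2 U) (\<kappa> p)))"
      by (intro partial_eqI) (simp add: axis_def r_def \<theta>_def \<Delta>_def D4 algebra_simps)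
    show "C 2 2 q * partial 2 f q
      = sin (q$3) * (((q$2)\<^sup>2 + a\<^sup>2) * D 1 U (\<kappa> q) + Kerr_Delta M (q$2) * D 2 U (\<kappa> q))" if "q \<in> O'" for q
      using range[OF that] by (simp add: C partial_f that Kerr_Delta_def field_simps)
  qed
  have D4U: "partial 4 f q = 0" if "q \<in> O'" for q
    using that by (simp add: partial_f U(2)[folded D_def] O'_def)
  have "Kerr_rho2 a r \<theta> > 0" "sin \<theta> > 0"
    using p_range \<open>M > 0\<close> by (simp_all add: Kerr_rho2_pos sin_gt_zero)
  then have "Kerr_rho2 a r \<theta> * sin \<theta> * wave_operator (Kerr_metric M a) f p
    = (\<Sum>i\<in>UNIV. \<Sum>j\<in>UNIV. partial i (\<lambda>q. C i j q * partial j f q) p)"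
    using p_range \<open>M > 0\<close> unfolding wave_operator_def C_def r_def \<theta>_def
    by (simp add: det_Kerr_metric abs_mult real_sqrt_mult flip: power_mult_distrib)
  also have "\<dots> = partial 1 (\<lambda>q. C 1 1 q * partial 1 f q) p + partial 2 (\<lambda>q. C 2 2 q * partial 2 f q) p
      + partial 3 (\<lambda>q. C 3 3 q * partial 3 f q) p"
    unfolding sum_4 by (simp add: zero C D4U T41)
  also have "\<dots> = sin \<theta> * (\<Delta> * D 2 (D 2 U) (\<kappa> p) + 2 * (r - M) * D 2 U (\<kappa> p)
      + 2 * (r\<^sup>2 + a\<^sup>2) * D 1 (D 2 U) (\<kappa> p) + 2 * r * D 1 U (\<kappa> p)
      + a\<^sup>2 * (sin \<theta>)\<^sup>2 * D 1 (D 1 U) (\<kappa> p) + D 3 (D 3 U) (\<kappa> p))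
    + cos \<theta> * D 3 U (\<kappa> p)"
  proof -
    \<comment> \<open>Symmetry merges the two mixed derivatives into \<open>2 (r^2 + a^2)\<close>
      times one of them, and the terms with \<open>(r^2 + a^2)^2 / \<Delta>\<close> in
      \<open>T11\<close> and \<open>T22\<close> cancel.\<close>
    have "D 2 (D 1 U) (\<kappa> p) = D 1 (D 2 U) (\<kappa> p)"
      unfolding D_def by (rule dir_deriv_commute[OF U(1) S(1) p])
    then show ?thesis
      unfolding T11 T22 T33 using \<Delta> by (simp add: field_simps power2_eq_square)
  qed
  also have "\<dots> = ingoing_wave M a U (\<kappa> p)"
    unfolding ingoing_wave_def Let_def \<kappa>_def ingoing_shift_nth r_def \<theta>_def \<Delta>_def D_def ..
  finally show ?thesis .
qed

section \<open>Regular solutions in ingoing coordinates\<close>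

lemma spherical_nth [simp]:
  "spherical r \<theta> \<phi> $ 1 = r * (sin \<theta> * cos \<phi>)"
  "spherical r \<theta> \<phi> $ 2 = r * (sin \<theta> * sin \<phi>)"
  "spherical r \<theta> \<phi> $ 3 = r * cos \<theta>"
  by (simp_all add: spherical_def)

lemma norm_spherical: "norm (spherical r \<theta> \<phi>) = \<bar>r\<bar>"
proof -
  have "(norm (spherical r \<theta> \<phi>))\<^sup>2
      = (r * (sin \<theta> * cos \<phi>))\<^sup>2 + (r * (sin \<theta> * sin \<phi>))\<^sup>2 + (r * cos \<theta>)\<^sup>2"
    unfolding power2_norm_eq_inner inner_vec_def sum_3 by (simp add: power2_eq_square)
  also have "\<dots> = r\<^sup>2 * ((sin \<theta>)\<^sup>2 * ((sin \<phi>)\<^sup>2 + (cos \<phi>)\<^sup>2) + (cos \<theta>)\<^sup>2)"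
    by algebra
  also have "\<dots> = r\<^sup>2" by simp
  finally show ?thesis
    using power2_eq_iff_nonneg[of "norm (spherical r \<theta> \<phi>)" "\<bar>r\<bar>"] by simp
qed

text \<open>This map is smooth on all of \<open>real^4\<close>, though not injective. Pulling a
  smooth function back along it therefore needs no special care at the poles.\<close>

definition ingoing_chart :: "real^4 \<Rightarrow> real \<times> (real^3)" where
  "ingoing_chart x = (x$1, spherical (x$2) (x$3) (x$4))"

lemma ingoing_point_eq: "ingoing_point rs \<phi>s q = ingoing_chart (ingoing_shift rs \<phi>s q)"
  by (simp add: ingoing_point_def ingoing_chart_def)

lemma smooth_on_ingoing_chart:
  assumes "smooth_on W F" "open S" "ingoing_chart ` S \<subseteq> W"
  shows "smooth_on S (\<lambda>x. F (ingoing_chart x))"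
  unfolding smooth_on_def
proof
  fix k
  have nth: "Ck_on k S (\<lambda>x::real^4. x$i)" for i
    by (intro Ck_on_bounded_linear \<open>open S\<close> bounded_linear_vec_nth)
  have sin: "Ck_on k S (\<lambda>x::real^4. sin (x$i))" and cos: "Ck_on k S (\<lambda>x::real^4. cos (x$i))" for i
    using Ck_on_compose[OF \<open>open S\<close> _ Ck_on_sin_cos(1), of "\<lambda>x. x$i"]
      Ck_on_compose[OF \<open>open S\<close> _ Ck_on_sin_cos(2), of "\<lambda>x. x$i"] nth[of i] by simp_all
  note mult = Ck_on_mult[OF \<open>open S\<close>]
  show "Ck_on k S (\<lambda>x. F (ingoing_chart x))"
  proof (rule Ck_on_compose[OF assms(2,3)])
    show "Ck_on k W F" using assms(1) by (simp add: smooth_on_def)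
    fix b :: "real \<times> (real^3)" assume "b \<in> Basis"
    then consider "b = (1, 0)" | i where "b = (0, axis i 1)"
      by (auto simp: Basis_prod_def Basis_vec_def)
    then show "Ck_on k S (\<lambda>x. ingoing_chart x \<bullet> b)"
    proof cases
      case 1
      then show ?thesis using nth[of 1] by (simp add: ingoing_chart_def)
    next
      case 2
      then have "(\<lambda>x. ingoing_chart x \<bullet> b) = (\<lambda>x. spherical (x$2) (x$3) (x$4) $ i)"
        by (simp add: ingoing_chart_def inner_axis fun_eq_iff)
      then show ?thesis
        using exhaust_3[of i] mult[OF nth mult[OF sin cos]] mult[OF nth mult[OF sin sin]] mult[OF nth cos]
        by auto
    qed
  qed
qed

lemma continuous_on_ingoing_chart: "continuous_on S ingoing_chart"
proof -
  have "continuous_on S (\<lambda>x::real^4. spherical (x$2) (x$3) (x$4) $ i)" for i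
    using exhaust_3[of i] by (elim disjE; simp; intro continuous_intros)
  then show ?thesis
    unfolding ingoing_chart_def by (intro continuous_intros) (subst continuous_on_componentwise, auto simp: Basis_vec_def inner_axis)
qed

lemma open_vimage_ingoing_chart: "open W \<Longrightarrow> open (ingoing_chart -` W)"
  by (rule open_vimage[OF _ continuous_on_ingoing_chart])

text \<open>Here \<open>U\<close> is \<open>u\<close> in the coordinates \<open>(v, r, \<theta>, \<phi>)\<close>, extended smoothly across the horizon.\<close>

locale ingoing_solution =
  fixes M a :: real and D :: "(real \<times> (real^3)) set" and u :: "real \<times> (real^3) \<Rightarrow> real"
    and \<Omega> :: "(real^4) set" and U :: "real^4 \<Rightarrow> real"
  assumes M_pos: "M > 0" and extremal: "a\<^sup>2 = M\<^sup>2" and open_D: "open D" and open_\<Omega>: "open \<Omega>"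
    and smooth: "smooth_on \<Omega> U"
    and U_eq: "\<And>x. M \<le> x$2 \<Longrightarrow> ingoing_chart x \<in> D \<Longrightarrow> x \<in> \<Omega> \<and> U x = u (ingoing_chart x)"
    and wave: "\<And>x. M < x$2 \<Longrightarrow> 0 < x$3 \<Longrightarrow> x$3 < pi \<Longrightarrow> ingoing_chart x \<in> D \<Longrightarrow> ingoing_wave M a U x = 0"

text \<open>The smooth extension provided by regularity is pulled back to the coordinates
  \<open>(v, r, \<theta>, \<phi>)\<close>. The singular Boyer--Lindquist equation is used only off
  the axis and outside the horizon, where it is equivalent to the regular one.\<close>

lemma regular_axisymmetric_solutionE:
  assumes u: "regular_axisymmetric_solution M a rs \<phi>s D u"
    and "M > 0" "a\<^sup>2 = M\<^sup>2" "open D" and rs: "tortoise M a rs" and \<phi>s: "angular_shift M a \<phi>s"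
  obtains \<Omega> U where "ingoing_solution M a D u \<Omega> U"
proof -
  obtain W F where W: "open W" "D \<inter> horizon_exterior M \<subseteq> W" and F: "smooth_on W F"
    and Fu: "\<And>y. y \<in> D \<inter> horizon_exterior M \<Longrightarrow> F y = u y"
    using u unfolding regular_axisymmetric_solution_def smooth_up_to_boundary_def by blast
  define \<Omega> where "\<Omega> = ingoing_chart -` W"
  define U where "U x = F (ingoing_chart x)" for x
  have "open \<Omega>" unfolding \<Omega>_def by (rule open_vimage_ingoing_chart[OF W(1)])
  have U: "smooth_on \<Omega> U"
    unfolding U_def by (rule smooth_on_ingoing_chart[OF F \<open>open \<Omega>\<close>]) (simp add: \<Omega>_def)
  have ext: "ingoing_chart x \<in> D \<inter> horizon_exterior M" if "M \<le> x$2" "ingoing_chart x \<in> D" for x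
    using that \<open>M > 0\<close> by (simp add: ingoing_chart_def horizon_exterior_def norm_spherical)
  have Uu: "x \<in> \<Omega> \<and> U x = u (ingoing_chart x)" if "M \<le> x$2" "ingoing_chart x \<in> D" for x
    using ext[OF that] W(2) Fu by (auto simp: \<Omega>_def U_def)
  \<comment> \<open>The open part of the coordinate domain on which the Boyer--Lindquist hypotheses
    are available.\<close>
  define S where "S = {x. M < x$2 \<and> 0 < x$3 \<and> x$3 < pi} \<inter> ingoing_chart -` D"
  have "open S"
    unfolding S_def
    by (intro open_Int open_vimage_ingoing_chart[OF \<open>open D\<close>] open_Collect_conj open_Collect_less continuous_intros)
  have "S \<subseteq> \<Omega>" using Uu by (auto simp: S_def)
  have SU: "smooth_on S U"
    unfolding U_def by (rule smooth_on_ingoing_chart[OF F \<open>open S\<close>]) (use \<open>S \<subseteq> \<Omega>\<close> in \<open>auto simp: \<Omega>_def\<close>)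
  have wave: "wave_operator (Kerr_metric M a) (u \<circ> ingoing_point rs \<phi>s) q = 0"
      "partial 4 (u \<circ> ingoing_point rs \<phi>s) q = 0"
      "(u \<circ> ingoing_point rs \<phi>s) q = U (ingoing_shift rs \<phi>s q)" if "ingoing_shift rs \<phi>s q \<in> S" for q
  proof -
    have "M < q$2 \<and> 0 < q$3 \<and> q$3 < pi \<and> ingoing_point rs \<phi>s q \<in> D"
      using that by (simp add: S_def ingoing_point_eq)
    then show "wave_operator (Kerr_metric M a) (u \<circ> ingoing_point rs \<phi>s) q = 0"
      "partial 4 (u \<circ> ingoing_point rs \<phi>s) q = 0"
      using u unfolding regular_axisymmetric_solution_def by blast+
    show "(u \<circ> ingoing_point rs \<phi>s) q = U (ingoing_shift rs \<phi>s q)"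
      using Uu[of "ingoing_shift rs \<phi>s q"] that by (simp add: S_def ingoing_point_eq)
  qed
  \<comment> \<open>The shift preserves \<open>r\<close>, so the shift with the negated functions
    undoes it.\<close>
  have inv: "\<exists>q. ingoing_shift rs \<phi>s q = x" for x
    by (rule exI[of _ "ingoing_shift (\<lambda>r. - rs r) (\<lambda>r. - \<phi>s r) x"]) (simp add: vec_eq_iff forall_4)
  have U4: "coord_deriv 4 U x = 0" if "x \<in> S" for x
  proof -
    obtain q where q: "ingoing_shift rs \<phi>s q = x" using inv by blast
    have shift: "ingoing_shift rs \<phi>s (q + s *\<^sub>R axis 4 1) = x + s *\<^sub>R axis 4 1" for s
      by (simp add: vec_eq_iff forall_4 axis_def flip: q)
    have "((\<lambda>s. U (x + s *\<^sub>R axis 4 1)) has_real_derivative coord_deriv 4 U (x + 0 *\<^sub>R axis 4 1)) (at 0)"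
      using that by (intro smooth_on_curve_has_real_derivative[OF SU]) (auto intro!: derivative_eq_intros)
    moreover have "open ((\<lambda>s. x + s *\<^sub>R axis 4 1) -` S)"
      by (intro open_vimage \<open>open S\<close> continuous_intros)
    ultimately have "((\<lambda>s. (u \<circ> ingoing_point rs \<phi>s) (q + s *\<^sub>R axis 4 1)) has_real_derivative coord_deriv 4 U x) (at 0)"
      using that wave(3) by (auto elim!: has_field_derivative_transform_within_open simp: shift)
    from partial_eqI[OF this] wave(2)[of q] show ?thesis using that q by (simp add: o_def)
  qed
  have "ingoing_wave M a U x = 0" if "M < x$2" "0 < x$3" "x$3 < pi" "ingoing_chart x \<in> D" for x
  proof -
    obtain q where q: "ingoing_shift rs \<phi>s q = x" using inv by blast
    have "x \<in> S" using that by (simp add: S_def)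
    have "ingoing_wave M a U (ingoing_shift rs \<phi>s q)
      = Kerr_rho2 a (q$2) (q$3) * sin (q$3) * wave_operator (Kerr_metric M a) (u \<circ> ingoing_point rs \<phi>s) q"
      using \<open>x \<in> S\<close> q by (intro wave_operator_ingoing[symmetric, OF \<open>M > 0\<close> rs \<phi>s \<open>open S\<close> _ SU U4] wave(3)) (simp_all add: S_def)
    then show ?thesis using wave(1)[of q] \<open>x \<in> S\<close> q by simp
  qed
  then have "ingoing_solution M a D u \<Omega> U"
    using Uu by (intro ingoing_solution.intro assms \<open>open \<Omega>\<close> U) blast+
  then show thesis by (rule that)
qed


section \<open>The meridian \<phi> = 0 in ingoing coordinates\<close>

definition meridian :: "real \<Rightarrow> real \<Rightarrow> real \<Rightarrow> real^4" where
  "meridian v r \<theta> = v *\<^sub>R axis 1 1 + r *\<^sub>R axis 2 1 + \<theta> *\<^sub>R axis 3 1"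

lemma meridian_nth [simp]:
  "meridian v r \<theta> $ 1 = v" "meridian v r \<theta> $ 2 = r" "meridian v r \<theta> $ 3 = \<theta>" "meridian v r \<theta> $ 4 = 0"
  by (simp_all add: meridian_def axis_def)

lemma ingoing_chart_meridian [simp]: "ingoing_chart (meridian v r \<theta>) = (v, spherical r \<theta> 0)"
  by (simp add: ingoing_chart_def)

lemma meridian_has_real_derivative:
  assumes "smooth_on \<Omega> H" "meridian v r \<theta> \<in> \<Omega>"
  shows "((\<lambda>v. H (meridian v r \<theta>)) has_real_derivative coord_deriv 1 H (meridian v r \<theta>)) (at v within A)"
    and "((\<lambda>r. H (meridian v r \<theta>)) has_real_derivative coord_deriv 2 H (meridian v r \<theta>)) (at r within A)"
    and "((\<lambda>\<theta>. H (meridian v r \<theta>)) has_real_derivative coord_deriv 3 H (meridian v r \<theta>)) (at \<theta> within A)"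
proof -
  have "((\<lambda>v. meridian v r \<theta>) has_vector_derivative axis 1 1) (at v within A)"
    "((\<lambda>r. meridian v r \<theta>) has_vector_derivative axis 2 1) (at r within A)"
    "((\<lambda>\<theta>. meridian v r \<theta>) has_vector_derivative axis 3 1) (at \<theta> within A)"
    unfolding meridian_def by (auto intro!: derivative_eq_intros)
  from this[THEN smooth_on_curve_has_real_derivative[OF assms(1)]] assms(2)
  show "((\<lambda>v. H (meridian v r \<theta>)) has_real_derivative coord_deriv 1 H (meridian v r \<theta>)) (at v within A)"
    "((\<lambda>r. H (meridian v r \<theta>)) has_real_derivative coord_deriv 2 H (meridian v r \<theta>)) (at r within A)"
    "((\<lambda>\<theta>. H (meridian v r \<theta>)) has_real_derivative coord_deriv 3 H (meridian v r \<theta>)) (at \<theta> within A)"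
    by blast+
qed

lemma continuous_on_meridian:
  assumes "smooth_on \<Omega> H" "continuous_on T f" "continuous_on T g" "continuous_on T h"
    and "\<And>t. t \<in> T \<Longrightarrow> meridian (f t) (g t) (h t) \<in> \<Omega>"
  shows "continuous_on T (\<lambda>t. H (meridian (f t) (g t) (h t)))"
proof (rule continuous_on_compose2[OF smooth_on_continuous[OF assms(1)]])
  show "continuous_on T (\<lambda>t. meridian (f t) (g t) (h t))"
    unfolding meridian_def by (intro continuous_intros assms)
qed (use assms(5) in auto)

section \<open>The horizon charge\<close>

lemma is_interval_not_bdd_above_eventually:
  fixes J :: "real set"
  assumes "is_interval J" "\<not> bdd_above J"
  shows "\<forall>\<^sub>F v in at_top. v \<in> J"
proof -
  obtain v0 where "v0 \<in> J" using assms(2) by force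
  have "v \<in> J" if "v \<ge> v0" for v
  proof -
    obtain w where "w \<in> J" "\<not> w \<le> v" using assms(2) unfolding bdd_above_def by blast
    then show ?thesis
      using assms(1) \<open>v0 \<in> J\<close> that unfolding is_interval_1 by (meson le_cases)
  qed
  then show ?thesis using eventually_ge_at_top[of v0] by (rule eventually_mono[rotated])
qed

context ingoing_solution
begin

text \<open>The horizon quantities of \<open>u\<close> become derivatives of the extension
  \<open>U\<close>. On the horizon \<open>u\<close> and \<open>U\<close> agree for all nearby
  \<open>v\<close>, which gives the two-sided v-derivative; across it they agree only for
  \<open>r \<ge> M\<close>, which suffices because \<open>horizon_dr\<close> is one-sided.\<close>

lemma horizon_values:
  assumes D: "(v, spherical M \<theta> 0) \<in> D"
  shows "meridian v M \<theta> \<in> \<Omega>"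
    and "horizon_u M u v \<theta> = U (meridian v M \<theta>)"
    and "horizon_dv M u v \<theta> = coord_deriv 1 U (meridian v M \<theta>)"
    and "horizon_dr M u v \<theta> = coord_deriv 2 U (meridian v M \<theta>)"
proof -
  show \<Omega>: "meridian v M \<theta> \<in> \<Omega>" and "horizon_u M u v \<theta> = U (meridian v M \<theta>)"
    using U_eq[of "meridian v M \<theta>"] D by (simp_all add: horizon_u_def)
  have "open ((\<lambda>s. (s, spherical M \<theta> 0)) -` D)"
    by (intro open_vimage open_D continuous_intros)
  then have "((\<lambda>s. u (s, spherical M \<theta> 0)) has_real_derivative coord_deriv 1 U (meridian v M \<theta>)) (at v)"
    using U_eq[of "meridian s M \<theta>" for s] D
    by (intro has_field_derivative_transform_within_open[OF meridian_has_real_derivative(1)[OF smooth \<Omega>, of UNIV]]) auto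
  then show "horizon_dv M u v \<theta> = coord_deriv 1 U (meridian v M \<theta>)"
    unfolding horizon_dv_def by (rule DERIV_imp_deriv)
  have "continuous_on UNIV (\<lambda>r. (v, spherical r \<theta> 0))"
    unfolding spherical_def by (intro continuous_intros)
  then have "open ((\<lambda>r. (v, spherical r \<theta> 0)) -` D)"
    by (rule open_vimage[OF open_D])
  then obtain d where d: "d > 0" "\<And>r. dist r M < d \<Longrightarrow> (v, spherical r \<theta> 0) \<in> D"
    using D unfolding open_dist by auto
  have "((\<lambda>r. u (v, spherical r \<theta> 0)) has_real_derivative coord_deriv 2 U (meridian v M \<theta>)) (at M within {M..})"
    using U_eq[of "meridian v r \<theta>" for r] d
    by (intro has_field_derivative_transform_within[OF meridian_has_real_derivative(2)[OF smooth \<Omega>, of "{M..}"] d(1)]) auto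
  then show "horizon_dr M u v \<theta> = coord_deriv 2 U (meridian v M \<theta>)"
    unfolding horizon_dr_def
    by (intro vector_derivative_within) (simp_all add: at_within_Ici_at_right has_real_derivative_iff_has_vector_derivative)
qed

text \<open>The equation holds for \<open>r > M\<close> and passes to \<open>r = M\<close> by
  continuity. There \<Delta> and its derivative \<open>2 (r - M)\<close> both vanish, and
  \<open>a^2 = M^2\<close> turns \<open>2 (r^2 + a^2)\<close> into \<open>4 M^2\<close>. The left
  side is the v-derivative of the charge integrand, the right side a total
  \<theta>-derivative.\<close>

lemma ingoing_wave_horizon:
  assumes D: "(v, spherical M \<theta> 0) \<in> D" and \<theta>: "0 < \<theta>" "\<theta> < pi"
  shows "sin \<theta> * (4 * M\<^sup>2 * coord_deriv 1 (coord_deriv 2 U) (meridian v M \<theta>) + 2 * M * coord_deriv 1 U (meridian v M \<theta>)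
      + M\<^sup>2 * (sin \<theta>)\<^sup>2 * coord_deriv 1 (coord_deriv 1 U) (meridian v M \<theta>))
    = - (sin \<theta> * coord_deriv 3 (coord_deriv 3 U) (meridian v M \<theta>) + cos \<theta> * coord_deriv 3 U (meridian v M \<theta>))"
proof -
  have cont: "continuous (at_right M) (\<lambda>r. H (meridian v r \<theta>))" if "smooth_on \<Omega> H" for H
    using meridian_has_real_derivative(2)[OF that horizon_values(1)[OF D]]
    by (rule DERIV_continuous)
  note DU = smooth_on_dir_deriv[OF smooth]
  have "continuous (at_right M) (\<lambda>r. ingoing_wave M a U (meridian v r \<theta>))"
    unfolding ingoing_wave_def Let_def meridian_nth Kerr_Delta_def
    by (intro continuous_intros cont DU smooth_on_dir_deriv[OF DU])
  then have "((\<lambda>r. ingoing_wave M a U (meridian v r \<theta>)) \<longlongrightarrow> ingoing_wave M a U (meridian v M \<theta>)) (at_right M)"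
    by (simp add: continuous_within)
  moreover have "\<forall>\<^sub>F r in at_right M. ingoing_wave M a U (meridian v r \<theta>) = 0"
  proof -
    have "continuous_on UNIV (\<lambda>r. (v, spherical r \<theta> 0))"
      unfolding spherical_def by (intro continuous_intros)
    then have "open ((\<lambda>r. (v, spherical r \<theta> 0)) -` D)"
      by (rule open_vimage[OF open_D])
    then have "\<forall>\<^sub>F r in at_right M. r \<in> (\<lambda>r. (v, spherical r \<theta> 0)) -` D"
      using D by (auto simp: eventually_at_topological)
    then show ?thesis
      using eventually_at_right_less[of M]
      by eventually_elim (use wave \<theta> in auto)
  qed
  then have "((\<lambda>r. ingoing_wave M a U (meridian v r \<theta>)) \<longlongrightarrow> 0) (at_right M)"
    by (rule tendsto_eventually)
  ultimately have "ingoing_wave M a U (meridian v M \<theta>) = 0"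
    using tendsto_unique trivial_limit_at_right_real by blast
  then show ?thesis
    unfolding ingoing_wave_def Let_def meridian_nth Kerr_Delta_def extremal
    by (simp add: algebra_simps)
qed

lemma Kerr_charge_conserved:
  assumes J: "is_interval J" "future_horizon M J \<subseteq> D"
  shows "\<exists>A. \<forall>v\<in>J. Kerr_charge M u v = A"
proof -
  have D: "(v, spherical M \<theta> 0) \<in> D" if "v \<in> J" for v \<theta>
    using J(2) that M_pos by (auto simp: future_horizon_def norm_spherical)
  note horizon = horizon_values[OF D]
  define q where "q v \<theta> = (4 * M\<^sup>2 * coord_deriv 2 U (meridian v M \<theta>) + 2 * M * U (meridian v M \<theta>)
      + M\<^sup>2 * (sin \<theta>)\<^sup>2 * coord_deriv 1 U (meridian v M \<theta>)) * sin \<theta>" for v \<theta>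
  define q' where "q' v \<theta> = (4 * M\<^sup>2 * coord_deriv 1 (coord_deriv 2 U) (meridian v M \<theta>)
      + 2 * M * coord_deriv 1 U (meridian v M \<theta>)
      + M\<^sup>2 * (sin \<theta>)\<^sup>2 * coord_deriv 1 (coord_deriv 1 U) (meridian v M \<theta>)) * sin \<theta>" for v \<theta>
  have charge: "Kerr_charge M u v = integral (cbox 0 pi) (q v)" if "v \<in> J" for v
    unfolding Kerr_charge_def q_def by (simp add: horizon[OF that])
  note DU = smooth_on_dir_deriv[OF smooth]
  have zero: "integral (cbox 0 pi) (q' v) = 0" if v: "v \<in> J" for v
  proof -
    have "((\<lambda>\<theta>. sin \<theta> * coord_deriv 3 (coord_deriv 3 U) (meridian v M \<theta>) + cos \<theta> * coord_deriv 3 U (meridian v M \<theta>))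
      has_integral sin pi * coord_deriv 3 U (meridian v M pi) - sin 0 * coord_deriv 3 U (meridian v M 0)) {0..pi}"
    proof (intro fundamental_theorem_of_calculus)
      fix \<theta> :: real
      show "((\<lambda>\<theta>. sin \<theta> * coord_deriv 3 U (meridian v M \<theta>)) has_vector_derivative
        sin \<theta> * coord_deriv 3 (coord_deriv 3 U) (meridian v M \<theta>) + cos \<theta> * coord_deriv 3 U (meridian v M \<theta>))
        (at \<theta> within {0..pi})"
        using DERIV_mult[OF has_field_derivative_at_within[OF DERIV_sin] meridian_has_real_derivative(3)[OF DU horizon(1)[OF v]]]
        by (simp add: algebra_simps flip: has_real_derivative_iff_has_vector_derivative)
    qed simp
    from has_integral_neg[OF this]
    have "((\<lambda>\<theta>. - (sin \<theta> * coord_deriv 3 (coord_deriv 3 U) (meridian v M \<theta>) + cos \<theta> * coord_deriv 3 U (meridian v M \<theta>)))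
      has_integral 0) (cbox 0 pi)"
      by simp
    \<comment> \<open>The horizon identity is available only for \<theta> strictly between 0 and pi;
      the two poles do not affect the integral.\<close>
    then have "(q' v has_integral 0) (cbox 0 pi)"
    proof (rule has_integral_spike_interior)
      fix \<theta> :: real assume "\<theta> \<in> box 0 pi"
      then show "q' v \<theta> = - (sin \<theta> * coord_deriv 3 (coord_deriv 3 U) (meridian v M \<theta>) + cos \<theta> * coord_deriv 3 U (meridian v M \<theta>))"
        using ingoing_wave_horizon[OF D[OF v], of \<theta>]
        by (simp add: q'_def mult.commute)
    qed
    then show ?thesis by (rule integral_unique)
  qed
  \<comment> \<open>Differentiation under the integral is done within \<open>J\<close>, which may
    contain its endpoints.\<close>
  have "((\<lambda>v. integral (cbox 0 pi) (q v)) has_field_derivative integral (cbox 0 pi) (q' v)) (at v within J)"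
    if "v \<in> J" for v
  proof (rule leibniz_rule_field_derivative)
    show "((\<lambda>v. q v \<theta>) has_field_derivative q' v \<theta>) (at v within J)" if "v \<in> J" for v \<theta>
      unfolding q_def q'_def
      by (intro DERIV_cmult_right DERIV_add DERIV_cmult meridian_has_real_derivative(1)[OF DU horizon(1)[OF that]]
          meridian_has_real_derivative(1)[OF smooth horizon(1)[OF that]])
    show "q v integrable_on cbox 0 pi" if "v \<in> J" for v
      unfolding q_def
      by (intro integrable_continuous continuous_intros continuous_on_meridian[OF DU]
          continuous_on_meridian[OF smooth] horizon(1)[OF that])
    show "continuous_on (J \<times> cbox 0 pi) (\<lambda>(v, \<theta>). q' v \<theta>)"
      unfolding q'_def split_beta
      by (intro continuous_intros continuous_on_meridian[OF DU] continuous_on_meridian[OF smooth_on_dir_deriv[OF DU]])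
        (auto intro: horizon(1))
  qed (use that J(1) in \<open>simp_all add: is_interval_convex\<close>)
  then have "\<exists>A. \<forall>v\<in>J. integral (cbox 0 pi) (q v) = A"
    using zero J(1) by (intro has_field_derivative_zero_constant) (auto simp: is_interval_convex)
  then show ?thesis using charge by metis
qed

text \<open>The contrapositive form of non-decay: if the averaged transversal derivative tended to 0
  as well, every term of the constant charge would tend to 0.\<close>

lemma Kerr_charge_zero_of_decay:
  assumes J: "is_interval J" "future_horizon M J \<subseteq> D" "\<not> bdd_above J"
    and A: "\<And>v. v \<in> J \<Longrightarrow> Kerr_charge M u v = A"
    and u: "uniform_limit {0..pi} (horizon_u M u) (\<lambda>_. 0) at_top"
    and dv: "uniform_limit {0..pi} (horizon_dv M u) (\<lambda>_. 0) at_top"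
    and dr: "((\<lambda>v. integral {0..pi} (\<lambda>\<theta>. horizon_dr M u v \<theta> * sin \<theta>)) \<longlongrightarrow> 0) at_top"
  shows "A = 0"
proof -
  have D: "(v, spherical M \<theta> 0) \<in> D" if "v \<in> J" for v \<theta>
    using J(2) that M_pos by (auto simp: future_horizon_def norm_spherical)
  note horizon = horizon_values[OF D]
  note DU = smooth_on_dir_deriv[OF smooth]
  have cont: "continuous_on {0..pi} (horizon_u M u v)" "continuous_on {0..pi} (horizon_dv M u v)"
    "continuous_on {0..pi} (horizon_dr M u v)" if "v \<in> J" for v
    unfolding horizon(2-4)[OF that, abs_def]
    by (intro continuous_on_meridian[OF DU] continuous_on_meridian[OF smooth] continuous_intros horizon(1)[OF that])+
  define h where "h v \<theta> = (2 * M * horizon_u M u v \<theta> + M\<^sup>2 * (sin \<theta>)\<^sup>2 * horizon_dv M u v \<theta>) * sin \<theta>" for v \<theta>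
  have h_cont: "continuous_on {0..pi} (h v)" if "v \<in> J" for v
    unfolding h_def by (intro continuous_intros cont that)
  \<comment> \<open>The charge is known to be constant on \<open>J\<close> only, while the limits
    are taken at infinity.\<close>
  have inJ: "\<forall>\<^sub>F v in at_top. v \<in> J"
    by (rule is_interval_not_bdd_above_eventually[OF J(1,3)])
  have "((\<lambda>v. integral {0..pi} (h v)) \<longlongrightarrow> 0) at_top"
  proof (rule tendstoI)
    fix e :: real assume "e > 0"
    \<comment> \<open>Chosen so that the bound \<open>(2 M + M^2) d pi\<close> for the integral of
      \<open>h v\<close> equals \<open>e / 2\<close>.\<close>
    define d where "d = e / (2 * pi * (2 * M + M\<^sup>2))"
    have "2 * M + M\<^sup>2 > 0" using M_pos by (simp add: add_pos_pos)
    then have "d > 0" using \<open>e > 0\<close> by (simp add: d_def)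
    have "\<forall>\<^sub>F v in at_top. \<forall>\<theta>\<in>{0..pi}. dist (horizon_u M u v \<theta>) 0 < d"
      "\<forall>\<^sub>F v in at_top. \<forall>\<theta>\<in>{0..pi}. dist (horizon_dv M u v \<theta>) 0 < d"
      using u dv \<open>d > 0\<close> unfolding uniform_limit_iff by blast+
    with inJ show "\<forall>\<^sub>F v in at_top. dist (integral {0..pi} (h v)) 0 < e"
    proof eventually_elim
      case (elim v)
      have "norm (integral {0..pi} (h v)) \<le> ((2 * M + M\<^sup>2) * d) * (pi - 0)"
      proof (rule integral_bound[OF _ h_cont[OF elim(1)]])
        fix \<theta> :: real assume \<theta>: "\<theta> \<in> {0..pi}"
        have "\<bar>h v \<theta>\<bar> \<le> \<bar>2 * M * horizon_u M u v \<theta> + M\<^sup>2 * (sin \<theta>)\<^sup>2 * horizon_dv M u v \<theta>\<bar> * 1"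
          unfolding h_def abs_mult by (intro mult_left_mono) auto
        also have "\<dots> \<le> \<bar>2 * M * horizon_u M u v \<theta>\<bar> + \<bar>M\<^sup>2 * (sin \<theta>)\<^sup>2 * horizon_dv M u v \<theta>\<bar>"
          by simp
        also have "\<dots> = 2 * M * \<bar>horizon_u M u v \<theta>\<bar> + M\<^sup>2 * ((sin \<theta>)\<^sup>2 * \<bar>horizon_dv M u v \<theta>\<bar>)"
          using M_pos by (simp add: abs_mult)
        also have "\<dots> \<le> 2 * M * d + M\<^sup>2 * (1 * d)"
          using elim(2,3) \<theta> M_pos \<open>d > 0\<close>
          by (intro add_mono mult_left_mono mult_mono) (auto simp: abs_square_le_1 less_imp_le)
        finally show "norm (h v \<theta>) \<le> (2 * M + M\<^sup>2) * d"
          by (simp add: algebra_simps)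
      qed simp
      also have "\<dots> = e / 2"
        using \<open>2 * M + M\<^sup>2 > 0\<close> by (simp add: d_def)
      finally show ?case using \<open>e > 0\<close> by simp
    qed
  qed
  from tendsto_add[OF tendsto_mult[OF tendsto_const[of "4 * M\<^sup>2"] dr] this]
  have "((\<lambda>v. 4 * M\<^sup>2 * integral {0..pi} (\<lambda>\<theta>. horizon_dr M u v \<theta> * sin \<theta>) + integral {0..pi} (h v)) \<longlongrightarrow> 0) at_top"
    by simp
  moreover have "\<forall>\<^sub>F v in at_top. 4 * M\<^sup>2 * integral {0..pi} (\<lambda>\<theta>. horizon_dr M u v \<theta> * sin \<theta>) + integral {0..pi} (h v) = A"
    using inJ
  proof eventually_elim
    case (elim v)
    have "(\<lambda>\<theta>. 4 * M\<^sup>2 * (horizon_dr M u v \<theta> * sin \<theta>)) integrable_on {0..pi}" "h v integrable_on {0..pi}"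
      by (intro integrable_continuous_real continuous_intros cont h_cont elim)+
    from integral_add[OF this]
    have "4 * M\<^sup>2 * integral {0..pi} (\<lambda>\<theta>. horizon_dr M u v \<theta> * sin \<theta>) + integral {0..pi} (h v)
      = integral {0..pi} (\<lambda>\<theta>. 4 * M\<^sup>2 * (horizon_dr M u v \<theta> * sin \<theta>) + h v \<theta>)"
      by simp
    also have "\<dots> = Kerr_charge M u v"
      unfolding Kerr_charge_def h_def by (intro integral_cong) (simp add: algebra_simps)
    finally show ?case using A[OF elim] by simp
  qed
  from tendsto_eventually[OF this] have "((\<lambda>v. 4 * M\<^sup>2 * integral {0..pi} (\<lambda>\<theta>. horizon_dr M u v \<theta> * sin \<theta>)
    + integral {0..pi} (h v)) \<longlongrightarrow> A) at_top" .
  ultimately show "A = 0"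
    using tendsto_unique[OF trivial_limit_at_top_linorder] by blast
qed

end

section \<open>Stationary solutions\<close>

text \<open>An energy argument on spheres. On the meridian \<open>v = 0\<close> the function \<psi>
  is replaced by the extension \<open>U\<close>, whose radial derivatives exist up to and including
  \<open>r = M\<close>.\<close>

lemma stationary_solution_vanishes:
  assumes sol: "ingoing_solution M a UNIV u \<Omega> U"
    and stat: "\<And>v r \<theta> \<phi>. M \<le> r \<Longrightarrow> 0 \<le> \<theta> \<Longrightarrow> \<theta> \<le> pi \<Longrightarrow> u (v, spherical r \<theta> \<phi>) = \<psi> r \<theta>"
    and decay: "uniform_limit {0..pi} \<psi> (\<lambda>_. 0) at_top"
    and r: "M \<le> r" and \<theta>: "\<theta> \<in> {0..pi}"
  shows "\<psi> r \<theta> = 0"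
proof -
  interpret ingoing_solution M a UNIV u \<Omega> U by (rule sol)
  define x where "x = meridian 0"
  have \<Omega>: "meridian v r \<theta> \<in> \<Omega>" if "M \<le> r" for v r \<theta>
    using U_eq[of "meridian v r \<theta>"] that by simp
  have U_\<psi>: "U (meridian v r \<theta>) = \<psi> r \<theta>" if "M \<le> r" "0 \<le> \<theta>" "\<theta> \<le> pi" for v r \<theta>
    using U_eq[of "meridian v r \<theta>"] stat that by simp
  note DU = smooth_on_dir_deriv[OF smooth]
  have D1: "coord_deriv 1 U (meridian v r \<theta>) = 0" if "M \<le> r" "0 \<le> \<theta>" "\<theta> \<le> pi" for v r \<theta>
  proof (rule DERIV_unique)
    show "((\<lambda>v. U (meridian v r \<theta>)) has_real_derivative coord_deriv 1 U (meridian v r \<theta>)) (at v)"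
      by (rule meridian_has_real_derivative(1)[OF smooth \<Omega>[OF that(1)]])
    show "((\<lambda>v. U (meridian v r \<theta>)) has_real_derivative 0) (at v)"
      unfolding U_\<psi>[OF that] by simp
  qed
  have D11: "coord_deriv 1 (coord_deriv 1 U) (meridian v r \<theta>) = 0" if "M \<le> r" "0 \<le> \<theta>" "\<theta> \<le> pi" for v r \<theta>
  proof (rule DERIV_unique)
    show "((\<lambda>v. coord_deriv 1 U (meridian v r \<theta>)) has_real_derivative
      coord_deriv 1 (coord_deriv 1 U) (meridian v r \<theta>)) (at v)"
      by (rule meridian_has_real_derivative(1)[OF DU \<Omega>[OF that(1)]])
    show "((\<lambda>v. coord_deriv 1 U (meridian v r \<theta>)) has_real_derivative 0) (at v)"
      unfolding D1[OF that] by simp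
  qed
  \<comment> \<open>The v-derivative is known to vanish only for \<open>r \<ge> M\<close>. For
    \<open>r > M\<close> this holds on a neighbourhood in \<open>r\<close>, so its two-sided radial
    derivative vanishes too, and the derivatives commute.\<close>
  have D12: "coord_deriv 1 (coord_deriv 2 U) (meridian v r \<theta>) = 0" if "M < r" "0 \<le> \<theta>" "\<theta> \<le> pi" for v r \<theta>
  proof -
    have "coord_deriv 2 (coord_deriv 1 U) (meridian v r \<theta>) = 0"
    proof (rule DERIV_unique)
      show "((\<lambda>r. coord_deriv 1 U (meridian v r \<theta>)) has_real_derivative
        coord_deriv 2 (coord_deriv 1 U) (meridian v r \<theta>)) (at r)"
        by (rule meridian_has_real_derivative(2)[OF DU \<Omega>]) (use that in simp)
      show "((\<lambda>r. coord_deriv 1 U (meridian v r \<theta>)) has_real_derivative 0) (at r)"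
        using that by (intro has_field_derivative_transform_within_open[OF DERIV_const, of "{M<..}"]) (auto simp: D1)
    qed
    then show ?thesis
      using dir_deriv_commute[OF smooth open_\<Omega> \<Omega>] that by simp
  qed
  have wave: "sin \<theta> * (Kerr_Delta M r * coord_deriv 2 (coord_deriv 2 U) (x r \<theta>) + 2 * (r - M) * coord_deriv 2 U (x r \<theta>)
      + coord_deriv 3 (coord_deriv 3 U) (x r \<theta>)) + cos \<theta> * coord_deriv 3 U (x r \<theta>) = 0"
    if "M < r" "0 < \<theta>" "\<theta> < pi" for r \<theta>
    using wave[of "x r \<theta>"] that unfolding x_def ingoing_wave_def Let_def by (simp add: D1 D11 D12)
  have cont: "continuous_on T (\<lambda>t. H (x (f t) (g t)))"
    if "smooth_on \<Omega> H" "continuous_on T f" "continuous_on T g" "\<And>t. t \<in> T \<Longrightarrow> M \<le> f t"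
    for H and T :: "'t::topological_space set" and f g
    unfolding x_def using that by (intro continuous_on_meridian[OF that(1)] \<Omega>) auto
  have deriv: "((\<lambda>r. H (x r \<theta>)) has_real_derivative coord_deriv 2 H (x r \<theta>)) (at r within A)"
      "((\<lambda>\<theta>. H (x r \<theta>)) has_real_derivative coord_deriv 3 H (x r \<theta>)) (at \<theta> within A)"
    if "smooth_on \<Omega> H" "M \<le> r" for H r \<theta> A
    unfolding x_def by (rule meridian_has_real_derivative[OF that(1) \<Omega>[OF that(2)]])+
  \<comment> \<open>With \<open>E\<close>, \<open>Q\<close>, \<open>P\<close> the integrals of
    \<open>e\<close>, \<open>q\<close>, \<open>p\<close> over \<theta>, the relations are
    \<open>E' = 2 Q\<close> and \<open>P = \<Delta> Q\<close>, while \<open>p'\<close> is the radial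
    derivative of \<open>p\<close>.\<close>
  define e where "e r \<theta> = (U (x r \<theta>))\<^sup>2 * sin \<theta>" for r \<theta>
  define q where "q r \<theta> = U (x r \<theta>) * coord_deriv 2 U (x r \<theta>) * sin \<theta>" for r \<theta>
  define p where "p r \<theta> = Kerr_Delta M r * q r \<theta>" for r \<theta>
  define p' where "p' r \<theta> = (2 * (r - M) * (U (x r \<theta>) * coord_deriv 2 U (x r \<theta>))
      + Kerr_Delta M r * ((coord_deriv 2 U (x r \<theta>))\<^sup>2 + U (x r \<theta>) * coord_deriv 2 (coord_deriv 2 U) (x r \<theta>))) * sin \<theta>" for r \<theta>
  have q_cont: "continuous_on ({M..} \<times> cbox 0 pi) (\<lambda>(r, \<theta>). q r \<theta>)"
    and p'_cont: "continuous_on ({M..} \<times> cbox 0 pi) (\<lambda>(r, \<theta>). p' r \<theta>)"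
    unfolding q_def p'_def Kerr_Delta_def split_beta
    by (intro continuous_intros cont smooth DU smooth_on_dir_deriv[OF DU]; auto)+
  have integrable: "e r integrable_on cbox 0 pi" "q r integrable_on cbox 0 pi" "p r integrable_on cbox 0 pi"
    if "M \<le> r" for r
    unfolding e_def q_def p_def using that
    by (intro integrable_continuous continuous_intros cont smooth DU; simp)+
  have E': "((\<lambda>r. integral (cbox 0 pi) (e r)) has_real_derivative 2 * integral (cbox 0 pi) (q r)) (at r within {M..})"
    if "M \<le> r" for r
  proof -
    have "((\<lambda>r. integral (cbox 0 pi) (e r)) has_real_derivative integral (cbox 0 pi) (\<lambda>\<theta>. 2 * q r \<theta>)) (at r within {M..})"
    proof (rule leibniz_rule_field_derivative)
      show "((\<lambda>r. e r \<theta>) has_real_derivative 2 * q r \<theta>) (at r within {M..})" if "r \<in> {M..}" for r \<theta>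
        using DERIV_cmult_right[OF DERIV_power[OF deriv(1)[OF smooth, of r \<theta>], where n = 2], of "sin \<theta>"] that
        unfolding e_def q_def by (simp add: mult_ac)
      show "continuous_on ({M..} \<times> cbox 0 pi) (\<lambda>(r, \<theta>). 2 * q r \<theta>)"
        using continuous_on_mult_left[OF q_cont] by (simp add: split_beta)
    qed (use that integrable in auto)
    then show ?thesis by simp
  qed
  have P': "((\<lambda>r. integral (cbox 0 pi) (p r)) has_real_derivative integral (cbox 0 pi) (p' r)) (at r within {M..})"
    if "M \<le> r" for r
  proof (rule leibniz_rule_field_derivative)
    show "((\<lambda>r. p r \<theta>) has_real_derivative p' r \<theta>) (at r within {M..})" if "r \<in> {M..}" for r \<theta>
    proof -
      have K: "(Kerr_Delta M has_real_derivative 2 * (r - M)) (at r within {M..})"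
        unfolding Kerr_Delta_def by (auto intro!: derivative_eq_intros)
      have "M \<le> r" using that by simp
      show ?thesis
        using DERIV_mult[OF K DERIV_cmult_right[OF DERIV_mult[OF deriv(1)[OF smooth \<open>M \<le> r\<close>, of \<theta>]
            deriv(1)[OF DU[of "axis 2 1"] \<open>M \<le> r\<close>, of \<theta>]], of "sin \<theta>"]]
        unfolding p_def q_def p'_def by (simp add: algebra_simps power2_eq_square)
    qed
  qed (use that integrable p'_cont in auto)
  text \<open>Green's identity on the sphere, with the angular part of the wave equation.\<close>
  have P'_nonneg: "integral (cbox 0 pi) (p' r) \<ge> 0" if "M < r" for r
  proof -
    \<comment> \<open>The boundary term of the integration by parts in \<theta>; its factor sin
      \<theta> vanishes at both poles.\<close>
    define b where "b \<theta> = U (x r \<theta>) * (sin \<theta> * coord_deriv 3 U (x r \<theta>))" for \<theta>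
    define b' where "b' \<theta> = (coord_deriv 3 U (x r \<theta>))\<^sup>2 * sin \<theta>
      + U (x r \<theta>) * (sin \<theta> * coord_deriv 3 (coord_deriv 3 U) (x r \<theta>) + cos \<theta> * coord_deriv 3 U (x r \<theta>))" for \<theta>
    have "(b' has_integral b pi - b 0) {0..pi}"
    proof (rule fundamental_theorem_of_calculus)
      fix \<theta> :: real
      have "M \<le> r" using that by simp
      from DERIV_mult[OF deriv(2)[OF smooth this] DERIV_mult[OF has_field_derivative_at_within[OF DERIV_sin] deriv(2)[OF DU this]]]
      show "(b has_vector_derivative b' \<theta>) (at \<theta> within {0..pi})"
        unfolding b_def b'_def has_real_derivative_iff_has_vector_derivative[symmetric]
        by (simp add: algebra_simps power2_eq_square)
    qed simp
    moreover have "b pi = 0" "b 0 = 0" by (simp_all add: b_def)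
    ultimately have b': "(b' has_integral 0) (cbox 0 pi)" by simp
    have "(p' r has_integral integral (cbox 0 pi) (p' r)) (cbox 0 pi)"
      using that p'_cont
      by (intro integrable_integral integrable_continuous continuous_on_compose2[OF p'_cont, of _ "Pair r", simplified split_conv])
        (auto intro!: continuous_intros)
    from has_integral_add[OF this b']
    have "((\<lambda>\<theta>. p' r \<theta> + b' \<theta>) has_integral integral (cbox 0 pi) (p' r)) (cbox 0 pi)" by simp
    \<comment> \<open>Adding \<open>b'\<close>, whose integral is 0, and using \<open>U\<close>
      times the wave equation leaves only squares, weighted by \<Delta>, 1 and sin \<theta>, all
      nonnegative here.\<close>
    then have "((\<lambda>\<theta>. (Kerr_Delta M r * (coord_deriv 2 U (x r \<theta>))\<^sup>2 + (coord_deriv 3 U (x r \<theta>))\<^sup>2) * sin \<theta>)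
      has_integral integral (cbox 0 pi) (p' r)) (cbox 0 pi)"
    proof (rule has_integral_spike_interior)
      fix \<theta> :: real assume "\<theta> \<in> box 0 pi"
      then show "(Kerr_Delta M r * (coord_deriv 2 U (x r \<theta>))\<^sup>2 + (coord_deriv 3 U (x r \<theta>))\<^sup>2) * sin \<theta> = p' r \<theta> + b' \<theta>"
        using wave[OF that, of \<theta>] unfolding p'_def b'_def mem_box by (simp) algebra
    qed
    then show ?thesis
      by (rule has_integral_nonneg) (auto simp: Kerr_Delta_def intro!: mult_nonneg_nonneg add_nonneg_nonneg sin_ge_zero)
  qed
  have interior: "at r within {M..} = at r" if "M < r" for r
    using that by (intro at_within_interior) simp
  have P_nonneg: "integral (cbox 0 pi) (p r) \<ge> 0" if "M \<le> r" for r
  proof -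
    \<comment> \<open>Monotonicity starts from the value at the horizon, which is 0 because \<Delta>
      vanishes there.\<close>
    have "integral (cbox 0 pi) (p M) \<le> integral (cbox 0 pi) (p r)"
    proof (rule DERIV_nonneg_imp_increasing_open[OF that])
      show "\<exists>y. ((\<lambda>r. integral (cbox 0 pi) (p r)) has_real_derivative y) (at s) \<and> 0 \<le> y" if "M < s" for s
        using P'[of s] P'_nonneg[OF that] interior[OF that] that by auto
      show "continuous_on {M..r} (\<lambda>r. integral (cbox 0 pi) (p r))"
        by (rule DERIV_continuous_on[OF has_field_derivative_subset[OF P']]) auto
    qed
    moreover have "p M = (\<lambda>_. 0)" by (simp add: p_def Kerr_Delta_def fun_eq_iff)
    ultimately show ?thesis by simp
  qed
  have Q_nonneg: "integral (cbox 0 pi) (q r) \<ge> 0" if "M < r" for r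
  proof -
    have "Kerr_Delta M r > 0" using that by (simp add: Kerr_Delta_def)
    moreover have "p r = (\<lambda>\<theta>. Kerr_Delta M r * q r \<theta>)" by (simp add: p_def fun_eq_iff)
    ultimately show ?thesis using P_nonneg[of r] that by (simp add: zero_le_mult_iff)
  qed
  have E_mono: "integral (cbox 0 pi) (e r) \<le> integral (cbox 0 pi) (e s)" if "r \<le> s" for s
  proof (rule DERIV_nonneg_imp_increasing_open[OF that])
    show "\<exists>y. ((\<lambda>r. integral (cbox 0 pi) (e r)) has_real_derivative y) (at t) \<and> 0 \<le> y" if "r < t" for t
      using E'[of t] Q_nonneg[of t] interior[of t] r that by (auto intro!: exI[of _ "2 * integral (cbox 0 pi) (q t)"])
    show "continuous_on {r..s} (\<lambda>r. integral (cbox 0 pi) (e r))"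
      by (rule DERIV_continuous_on[OF has_field_derivative_subset[OF E']]) (use r in auto)
  qed
  have "((\<lambda>s. integral (cbox 0 pi) (e s)) \<longlongrightarrow> 0) at_top"
  proof (rule tendstoI)
    fix \<epsilon> :: real assume "\<epsilon> > 0"
    \<comment> \<open>Chosen so that \<open>d^2 pi\<close> equals
      \<open>\<epsilon> / 2\<close>.\<close>
    define d where "d = sqrt (\<epsilon> / (2 * pi))"
    have "d > 0" using \<open>\<epsilon> > 0\<close> by (simp add: d_def)
    then have "\<forall>\<^sub>F s in at_top. \<forall>\<theta>\<in>{0..pi}. dist (\<psi> s \<theta>) 0 < d"
      using decay unfolding uniform_limit_iff by blast
    with eventually_ge_at_top[of M] show "\<forall>\<^sub>F s in at_top. dist (integral (cbox 0 pi) (e s)) 0 < \<epsilon>"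
    proof eventually_elim
      case (elim s)
      have "norm (integral {0..pi} (e s)) \<le> d\<^sup>2 * (pi - 0)"
      proof (rule integral_bound)
        show "continuous_on {0..pi} (e s)"
          unfolding e_def using elim(1) by (intro continuous_intros cont smooth) auto
        fix \<theta> :: real assume \<theta>: "\<theta> \<in> {0..pi}"
        have "norm (e s \<theta>) = \<bar>\<psi> s \<theta>\<bar>\<^sup>2 * \<bar>sin \<theta>\<bar>"
          using U_\<psi>[of s \<theta> 0] elim(1) \<theta> by (simp add: e_def x_def abs_mult)
        also have "\<dots> \<le> d\<^sup>2 * 1"
          using elim(2) \<theta> by (intro mult_mono power_mono) (auto simp: less_imp_le)
        finally show "norm (e s \<theta>) \<le> d\<^sup>2" by simp
      qed simp
      also have "\<dots> = \<epsilon> / 2" using \<open>\<epsilon> > 0\<close> by (simp add: d_def)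
      finally show ?case using \<open>\<epsilon> > 0\<close> by simp
    qed
  qed
  moreover have "\<forall>\<^sub>F s in at_top. integral (cbox 0 pi) (e r) \<le> integral (cbox 0 pi) (e s)"
    using eventually_ge_at_top[of r] by eventually_elim (rule E_mono)
  ultimately have "integral (cbox 0 pi) (e r) \<le> 0"
    by (rule tendsto_lowerbound) simp
  moreover have e_cont: "continuous_on {0..pi} (e r)"
    unfolding e_def using r by (intro continuous_intros cont smooth) auto
  moreover have e_nonneg: "e r \<theta> \<ge> 0" if "\<theta> \<in> {0..pi}" for \<theta>
    using that by (simp add: e_def sin_ge_zero)
  ultimately have "integral {0..pi} (e r) = 0"
    using integral_nonneg[OF integrable_continuous_real[OF e_cont] e_nonneg] by simp
  then have e0: "\<forall>\<theta>\<in>{0..pi}. e r \<theta> = 0"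
    using integral_eq_0_iff[OF e_cont pi_gt_zero e_nonneg] by blast
  \<comment> \<open>Vanishing of \<open>e\<close> gives vanishing of \<open>U\<close> only where sin
    \<theta> is positive. The poles follow by continuity.\<close>
  have open_zero: "U (x r \<theta>) = 0" if "\<theta> \<in> {0<..<pi}" for \<theta>
    using e0 that sin_gt_zero[of \<theta>] by (fastforce simp: e_def)
  have "continuous_on {0..pi} (\<lambda>\<theta>. U (x r \<theta>))"
    by (rule cont[OF smooth continuous_on_const continuous_on_id]) (rule r)
  then have "continuous_on (closure {0<..<pi}) (\<lambda>\<theta>. U (x r \<theta>))" by simp
  from continuous_constant_on_closure[OF this open_zero, of \<theta>] \<theta>
  have "U (x r \<theta>) = 0" by simp
  then show ?thesis using U_\<psi>[OF r, of \<theta> 0] \<theta> by (simp add: x_def)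
qed


theorem theorem1p10:
  fixes M a :: real and rs \<phi>s :: "real \<Rightarrow> real"
  assumes "M > 0" and "\<bar>a\<bar> = M"
    and "tortoise M a rs" and "angular_shift M a \<phi>s"
  shows
    "(\<forall>D J u.
        open D \<and> is_interval J \<and> future_horizon M J \<subseteq> D \<and>
        regular_axisymmetric_solution M a rs \<phi>s D u \<longrightarrow>
        (\<exists>A. (\<forall>v\<in>J. Kerr_charge M u v = A) \<and>
             (A \<noteq> 0 \<and> \<not> bdd_above J \<and>
              uniform_limit {0..pi} (horizon_u M u) (\<lambda>_. 0) at_top \<and>
              uniform_limit {0..pi} (horizon_dv M u) (\<lambda>_. 0) at_top \<longrightarrow>
              \<not> ((\<lambda>v. integral {0..pi} (\<lambda>\<theta>. horizon_dr M u v \<theta> * sin \<theta>)) \<longlongrightarrow> 0) at_top))) \<and>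
     (\<forall>u \<psi> \<tau>.
        stationary_state M a rs \<phi>s u \<psi> \<and>
        slice_data \<tau> u \<in> smooth_radiation_space M \<and>
        uniform_limit {0..pi} \<psi> (\<lambda>_. 0) at_top \<longrightarrow>
        (\<forall>r\<ge>M. \<forall>\<theta>\<in>{0..pi}. \<psi> r \<theta> = 0))"
proof (intro conjI allI impI)
  have a2: "a\<^sup>2 = M\<^sup>2" using assms(2) by (metis power2_abs)
  note solE = regular_axisymmetric_solutionE[OF _ assms(1) a2 _ assms(3,4)]
  fix D J u
  assume *: "open D \<and> is_interval J \<and> future_horizon M J \<subseteq> D \<and> regular_axisymmetric_solution M a rs \<phi>s D u"
  then obtain \<Omega> U where sol: "ingoing_solution M a D u \<Omega> U" using solE by blast
  then interpret ingoing_solution M a D u \<Omega> U .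
  obtain A where A: "\<forall>v\<in>J. Kerr_charge M u v = A" using Kerr_charge_conserved * by blast
  show "\<exists>A. (\<forall>v\<in>J. Kerr_charge M u v = A) \<and>
             (A \<noteq> 0 \<and> \<not> bdd_above J \<and>
              uniform_limit {0..pi} (horizon_u M u) (\<lambda>_. 0) at_top \<and>
              uniform_limit {0..pi} (horizon_dv M u) (\<lambda>_. 0) at_top \<longrightarrow>
              \<not> ((\<lambda>v. integral {0..pi} (\<lambda>\<theta>. horizon_dr M u v \<theta> * sin \<theta>)) \<longlongrightarrow> 0) at_top)"
  proof (intro exI[of _ A] conjI impI A notI)
    assume decay: "A \<noteq> 0 \<and> \<not> bdd_above J \<and> uniform_limit {0..pi} (horizon_u M u) (\<lambda>_. 0) at_top \<and>
        uniform_limit {0..pi} (horizon_dv M u) (\<lambda>_. 0) at_top"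
      and dr: "((\<lambda>v. integral {0..pi} (\<lambda>\<theta>. horizon_dr M u v \<theta> * sin \<theta>)) \<longlongrightarrow> 0) at_top"
    have "A = 0"
      by (rule Kerr_charge_zero_of_decay[where J = J, OF _ _ _ _ _ _ dr]) (use A * decay in simp_all)
    with decay show False by simp
  qed
next
  have a2: "a\<^sup>2 = M\<^sup>2" using assms(2) by (metis power2_abs)
  fix u :: "real \<times> (real^3) \<Rightarrow> real" and \<psi> \<tau> r
  assume r: "M \<le> r" and *: "stationary_state M a rs \<phi>s u \<psi> \<and> slice_data \<tau> u \<in> smooth_radiation_space M \<and>
        uniform_limit {0..pi} \<psi> (\<lambda>_. 0) at_top"
  then obtain \<Omega> U where sol: "ingoing_solution M a UNIV u \<Omega> U"
    using regular_axisymmetric_solutionE[OF _ assms(1) a2 open_UNIV assms(3,4)]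
    unfolding stationary_state_def by blast
  show "\<forall>\<theta>\<in>{0..pi}. \<psi> r \<theta> = 0"
  proof
    show "\<psi> r \<theta> = 0" if "\<theta> \<in> {0..pi}" for \<theta>
      by (rule stationary_solution_vanishes[OF sol _ _ r that])
        (use * in \<open>simp_all add: stationary_state_def\<close>)
  qed
qed

end
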